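(* Let $H\in\mathbb{R}^{n\times n}$ be symmetric positive semi-definite, and let $\mathcal{S}(H)$ be the set of symmetric positive semi-definite $\tilde H\in\mathbb{R}^{n\times n}$ having the same eigenvalues as $H$, counted with multiplicity. Then $$\sup_{\tilde H\in\mathcal{S}(H)}\mathcal{L}_{\mathrm{worst}}(\mathsf{LDLQ},\tilde H)=\mathcal{L}_{\mathrm{worst}}(\mathsf{Stoch},H)=\tfrac{m}{4}\operatorname{tr}(H).$$ Moreover, if $\mathsf{LDLQ}$ uses nearest rounding as its subroutine $\mathcal{Q}$ (resp. stochastic rounding), then $$\sup_{\tilde H\in\mathcal{S}(H)}\mathcal{L}_{\mathrm{avg}}(\mathsf{LDLQ},\tilde H)=\mathcal{L}_{\mathrm{avg}}(\mathcal{B},H)=\tfrac{m}{c}\operatorname{tr}(H),$$ with $\mathcal{B}=\mathsf{Near}$ and $c=12$ (resp. $\mathcal{B}=\mathsf{Stoch}$ and $c=6$).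
   Context: Nearest rounding maps $z$ to a nearest integer. Unbiased stochastic rounding maps $z$ to $\lfloor z\rfloor+1$ with probability $z-\lfloor z\rfloor$ and to $\lfloor z\rfloor$ otherwise, independently each time. $\mathsf{LDLQ}$, with rounding subroutine $\mathcal{Q}$ applied entrywise, works as follows: given $W\in\mathbb{R}^{m\times n}$ and $H$ with LDL decomposition $H=(\grave U+I)D(\grave U+I)^T$ ($\grave U$ strictly upper triangular, $D$ nonnegative diagonal), compute for $k=1,\dots,n$ the column $\hat W_k=\mathcal{Q}(W_k+(W-\hat W)\grave U_k)$, where $X_k$ is the $k$-th column of $X$. $\mathsf{Near}$ / $\mathsf{Stoch}$ apply nearest / stochastic rounding entrywise to $W$. Proxy losses: $\mathcal{L}_{\mathrm{worst}}(\mathcal{A},H)=\sup_{W\in\mathbb{R}^{m\times n}}\mathbb{E}[\operatorname{tr}((\mathcal{A}(W,H)-W)H(\mathcal{A}(W,H)-W)^T)]$ and $\mathcal{L}_{\mathrm{avg}}(\mathcal{A},H)=\mathbb{E}_{W\sim\mathrm{Unif}[0,1]^{m\times n}}[\operatorname{tr}((\mathcal{A}(W,H)-W)H(\mathcal{A}(W,H)-W)^T)]$, with expectation over the rounding randomness (and over $W$). *)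

theory Defs
  imports "Jordan_Normal_Form.Char_Poly" "HOL-Probability.Probability"
begin

definition mtrace :: "real mat \<Rightarrow> real" where
  "mtrace A = (\<Sum>i<dim_row A. A $$ (i,i))"

definition sym_psd :: "real mat \<Rightarrow> bool" where
  "sym_psd H \<longleftrightarrow> H \<in> carrier_mat (dim_row H) (dim_row H) \<and> transpose_mat H = H \<and>
     (\<forall>x \<in> carrier_vec (dim_row H). 0 \<le> x \<bullet> (H *\<^sub>v x))"

definition eig_mult :: "real mat \<Rightarrow> real \<Rightarrow> nat" where
  "eig_mult A lam = order lam (char_poly A)"

definition same_spectrum_psd :: "real mat \<Rightarrow> real mat set" where
  "same_spectrum_psd H = {Ht. sym_psd Ht \<and> dim_row Ht = dim_row H \<and>
      (\<forall>lam. eig_mult Ht lam = eig_mult H lam)}"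

definition ldl_decomp :: "real mat \<Rightarrow> real mat \<Rightarrow> real mat \<Rightarrow> bool" where
  "ldl_decomp H U D \<longleftrightarrow> (let n = dim_row H in
     H \<in> carrier_mat n n \<and> U \<in> carrier_mat n n \<and> D \<in> carrier_mat n n \<and>
     (\<forall>i<n. \<forall>j<n. j \<le> i \<longrightarrow> U $$ (i,j) = 0) \<and>
     diagonal_mat D \<and> (\<forall>i<n. 0 \<le> D $$ (i,i)) \<and>
     H = (U + 1\<^sub>m n) * D * transpose_mat (U + 1\<^sub>m n))"

definition ldl_U :: "real mat \<Rightarrow> real mat" where
  "ldl_U H = fst (SOME (U, D). ldl_decomp H U D)"

text \<open>A rounding subroutine takes an auxiliary random number u \<in> [0,1] and z.
  Nearest rounding ignores u (ties rounded up); stochastic rounding rounds up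
  iff u < z - floor z, i.e. with probability z - floor z when u ~ Unif[0,1].\<close>
definition near_round :: "real \<Rightarrow> real \<Rightarrow> real" where
  "near_round u z = real_of_int \<lfloor>z + 1/2\<rfloor>"

definition stoch_round :: "real \<Rightarrow> real \<Rightarrow> real" where
  "stoch_round u z = (if u < z - real_of_int \<lfloor>z\<rfloor> then real_of_int \<lfloor>z\<rfloor> + 1 else real_of_int \<lfloor>z\<rfloor>)"

text \<open>An algorithm maps (W, H, randomness u) to the quantized matrix; u assigns an
  independent Unif[0,1] number to each entry (i,k).\<close>

definition entrywise :: "(real \<Rightarrow> real \<Rightarrow> real) \<Rightarrow> real mat \<Rightarrow> real mat \<Rightarrow> (nat \<times> nat \<Rightarrow> real) \<Rightarrow> real mat" where
  "entrywise Q W H u = Matrix.mat (dim_row W) (dim_col W) (\<lambda>(i,k). Q (u (i,k)) (W $$ (i,k)))"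

text \<open>One row of LDLQ: the first k quantized entries. Entry k is
  Q_k (w_k + sum_{j<k} (w_j - what_j) U_{jk}); since U is strictly upper triangular
  this is exactly the k-th entry of W_k + (W - What) U_k.\<close>
primrec ldlq_row :: "(nat \<Rightarrow> real \<Rightarrow> real) \<Rightarrow> (nat \<Rightarrow> real) \<Rightarrow> real mat \<Rightarrow> nat \<Rightarrow> real list" where
  "ldlq_row Q w U 0 = []"
| "ldlq_row Q w U (Suc k) = (let prev = ldlq_row Q w U k in
     prev @ [Q k (w k + (\<Sum>j<k. (w j - prev ! j) * U $$ (j,k)))])"

definition LDLQ :: "(real \<Rightarrow> real \<Rightarrow> real) \<Rightarrow> real mat \<Rightarrow> real mat \<Rightarrow> (nat \<times> nat \<Rightarrow> real) \<Rightarrow> real mat" where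
  "LDLQ Q W H u = (let U = ldl_U H; n = dim_col W in
     Matrix.mat (dim_row W) n (\<lambda>(i,k).
       ldlq_row (\<lambda>k'. Q (u (i,k'))) (\<lambda>j. W $$ (i,j)) U n ! k))"

definition unif01 :: "real measure" where
  "unif01 = uniform_measure lborel {0..1}"

definition unif_cube :: "nat \<Rightarrow> nat \<Rightarrow> (nat \<times> nat \<Rightarrow> real) measure" where
  "unif_cube m n = PiM ({0..<m} \<times> {0..<n}) (\<lambda>_. unif01)"

definition proxy :: "real mat \<Rightarrow> real mat \<Rightarrow> real mat \<Rightarrow> real" where
  "proxy What W H = mtrace ((What - W) * H * transpose_mat (What - W))"

type_synonym algo = "real mat \<Rightarrow> real mat \<Rightarrow> (nat \<times> nat \<Rightarrow> real) \<Rightarrow> real mat"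

definition L_worst :: "algo \<Rightarrow> nat \<Rightarrow> real mat \<Rightarrow> ereal" where
  "L_worst A m H = (SUP W \<in> carrier_mat m (dim_row H).
      ereal (\<integral>u. proxy (A W H u) W H \<partial>(unif_cube m (dim_row H))))"

definition L_avg :: "algo \<Rightarrow> nat \<Rightarrow> real mat \<Rightarrow> real" where
  "L_avg A m H = (let n = dim_row H in
     \<integral>w. (\<integral>u. proxy (A (Matrix.mat m n w) H u) (Matrix.mat m n w) H \<partial>(unif_cube m n)) \<partial>(unif_cube m n))"

end

theory Submission
  imports Defs "Jordan_Normal_Form.Schur_Decomposition"
begin

text \<open>
  With \<open>H = (U + I) D (U + I)\<^sup>T\<close>, the loss of LDLQ is the sum of \<open>D\<^sub>k \<eta>\<^sub>i\<^sub>k\<^sup>2\<close>, where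
  \<open>\<eta>\<^sub>i\<^sub>k\<close> is the error of a single rounding. The mean square of \<open>\<eta>\<^sub>i\<^sub>k\<close> is at most \<open>1/4\<close> in the
  worst case. For uniform weights it is exactly the constant of the rounding routine, since the number
  being rounded is uniform modulo 1 given the earlier entries of its row. As \<open>tr D \<le> tr H\<close>,
  and the trace depends only on the spectrum, this bounds the suprema. They are attained at a
  diagonal matrix of eigenvalues: there \<open>D = H\<close>, and every column with a nonzero pivot is rounded
  without feedback. For entrywise rounding, independent centered errors leave only the diagonal
  of \<open>H\<close>.
\<close>

subsection \<open>LDL decompositions\<close>

text \<open>A singular matrix has many LDL decompositions and \<open>ldl_U\<close> picks one of them
  arbitrarily, so no formula for the feedback matrix is available. The bounds are therefore proved
  for any decomposition with that factor, and only the pivots enter them. \<open>eig_mult\<close>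
  counts real roots only. Equal counts force equal traces once the characteristic polynomials are
  known to split over the reals, which is the reason for the detour through complex eigenvectors.
  Both rounding routines share what the argument needs: an error that is 1-periodic in the rounded
  number, bounded by 1, with mean square at most 1/4 and equal to 1/4 at the number 1/2. For nearest
  rounding this is the distance 1/2 to the nearest integer; for stochastic rounding it is the
  Bernoulli variance \<open>p * (1 - p)\<close>. The average-case constants are the integrals over
  one period: \<open>(1/2 - z)^2\<close> gives 1/12 and \<open>z * (1 - z)\<close> gives
  1/6.\<close>

lemma real_scalar_prod_sum:
  fixes x y :: "real Matrix.vec"
  shows "x \<bullet> y = (\<Sum>i<dim_vec y. x $ i * y $ i)"
  by (simp add: scalar_prod_def atLeast0LessThan)

lemma sym_psdD:
  assumes "H \<in> carrier_mat n n" "sym_psd H"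
  shows "\<And>i j. i < n \<Longrightarrow> j < n \<Longrightarrow> H $$ (i,j) = H $$ (j,i)"
    and "\<And>f. 0 \<le> (\<Sum>i<n. \<Sum>j<n. f i * H $$ (i,j) * f j)"
proof -
  fix i j assume ij: "i < n" "j < n"
  have "H $$ (i,j) = transpose_mat H $$ (i,j)"
    using assms(2) by (simp add: sym_psd_def)
  then show "H $$ (i,j) = H $$ (j,i)"
    using ij assms(1) by simp
next
  fix f :: "nat \<Rightarrow> real"
  have "0 \<le> Matrix.vec n f \<bullet> (H *\<^sub>v Matrix.vec n f)"
    using assms by (auto simp: sym_psd_def)
  also have "\<dots> = (\<Sum>i<n. \<Sum>j<n. f i * H $$ (i,j) * f j)"
    using assms(1)
    by (auto simp: real_scalar_prod_sum sum_distrib_left mult.assoc intro!: sum.cong)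
  finally show "0 \<le> (\<Sum>i<n. \<Sum>j<n. f i * H $$ (i,j) * f j)" .
qed

lemma quadratic_form_Suc:
  fixes h :: "nat \<Rightarrow> nat \<Rightarrow> real"
  assumes "\<And>i. i < n \<Longrightarrow> h n i = h i n"
  shows "(\<Sum>i<Suc n. \<Sum>j<Suc n. f i * h i j * f j) =
    (\<Sum>i<n. \<Sum>j<n. f i * h i j * f j) + 2 * f n * (\<Sum>i<n. f i * h i n) + f n * h n n * f n"
proof -
  have "(\<Sum>j<n. f n * h n j * f j) = f n * (\<Sum>i<n. f i * h i n)"
    using assms by (auto simp: sum_distrib_left intro!: sum.cong)
  moreover have "(\<Sum>i<n. f i * h i n * f n) = f n * (\<Sum>i<n. f i * h i n)"
    by (auto simp: sum_distrib_left intro!: sum.cong)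
  ultimately show ?thesis
    by (simp add: sum.distrib)
qed

text \<open>Recursion from the last index: eliminating it replaces the form by its Schur complement.
  If the pivot \<open>h n n\<close> vanishes, positivity forces its whole column to vanish, and the
  convention \<open>x / 0 = 0\<close> makes the formulas below cover this case as well.\<close>

lemma psd_form_factorization:
  fixes h :: "nat \<Rightarrow> nat \<Rightarrow> real"
  assumes "\<And>i j. i < n \<Longrightarrow> j < n \<Longrightarrow> h i j = h j i"
    and "\<And>f. 0 \<le> (\<Sum>i<n. \<Sum>j<n. f i * h i j * f j)"
  shows "\<exists>V d. (\<forall>i<n. 0 \<le> d i) \<and> (\<forall>i<n. V i i = 1) \<and> (\<forall>i<n. \<forall>j<i. V i j = 0) \<and>
    (\<forall>i<n. \<forall>j<n. h i j = (\<Sum>l<n. V i l * d l * V j l))"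
  using assms
proof (induction n arbitrary: h)
  case 0
  then show ?case by simp
next
  case (Suc n)
  define e where "e = h n n"
  have sym: "h n i = h i n" if "i < n" for i
    using Suc.prems(1)[of n i] that by simp
  have Q: "(\<Sum>i<Suc n. \<Sum>j<Suc n. f i * h i j * f j) =
    (\<Sum>i<n. \<Sum>j<n. f i * h i j * f j) + 2 * f n * (\<Sum>i<n. f i * h i n) + f n * h n n * f n" for f
    using sym by (rule quadratic_form_Suc)
  have e0: "0 \<le> e"
  proof -
    have "0 \<le> (\<Sum>i<Suc n. \<Sum>j<Suc n. (if i = n then 1 else 0) * h i j * (if j = n then 1 else 0))"
      by (rule Suc.prems(2))
    then show ?thesis unfolding Q e_def by simp
  qed
  have col0: "h i n = 0" if "e = 0" "i < n" for i
  proof (rule ccontr)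
    assume ne: "h i n \<noteq> 0"
    \<comment> \<open>With a vanishing pivot the form at the i-th unit vector plus \<open>s\<close>
      times the n-th one is affine in \<open>s\<close>; this value makes it equal to -1.\<close>
    define s where "s = - (h i i + 1) / (2 * h i n)"
    let ?f = "\<lambda>j. if j = n then s else if j = i then 1 else (0::real)"
    have "0 \<le> (\<Sum>i<n. \<Sum>j<n. ?f i * h i j * ?f j) + 2 * ?f n * (\<Sum>i<n. ?f i * h i n) + ?f n * h n n * ?f n"
      using Suc.prems(2)[of ?f] unfolding Q[of ?f] .
    moreover have "(\<Sum>k<n. \<Sum>j<n. ?f k * h k j * ?f j) = h i i"
    proof -
      have "(\<Sum>k<n. \<Sum>j<n. ?f k * h k j * ?f j)
        = (\<Sum>k<n. if k = i then (\<Sum>j<n. if j = i then h i i else 0) else 0)"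
      proof (rule sum.cong[OF refl])
        fix k assume "k \<in> {..<n}"
        show "(\<Sum>j<n. ?f k * h k j * ?f j) = (if k = i then (\<Sum>j<n. if j = i then h i i else 0) else 0)"
        proof (cases "k = i")
          case True
          have "(\<Sum>j<n. ?f i * h i j * ?f j) = (\<Sum>j<n. if j = i then h i i else 0)"
            using that by (intro sum.cong refl) auto
          with True show ?thesis by (simp only: simp_thms if_True)
        next
          case False
          with \<open>k \<in> {..<n}\<close> show ?thesis by simp
        qed
      qed
      also have "\<dots> = h i i"
        using that by simp
      finally show ?thesis .
    qed
    moreover have "(\<Sum>k<n. ?f k * h k n) = h i n"
    proof -
      have "(\<Sum>k<n. ?f k * h k n) = (\<Sum>k<n. if k = i then h i n else 0)"
        by (intro sum.cong refl) auto
      then show ?thesis using that by simp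
    qed
    moreover have "?f n = s" by simp
    ultimately have "0 \<le> h i i + 2 * s * h i n"
      using \<open>e = 0\<close> by (simp only: e_def mult_zero_left mult_zero_right add_0_right)
    moreover have "2 * s * h i n = - (h i i + 1)"
      using ne by (simp add: s_def)
    ultimately show False by simp
  qed
  define h' where "h' = (\<lambda>i j. h i j - h i n * h j n / e)"
  have psd': "0 \<le> (\<Sum>i<n. \<Sum>j<n. f i * h' i j * f j)" for f
  proof -
    define B where "B = (\<Sum>i<n. f i * h i n)"
    \<comment> \<open>The last coordinate minimizes the form when \<open>e > 0\<close>, which leaves
      the Schur complement. If \<open>e = 0\<close>, the coordinate is 0 and nothing is
      subtracted.\<close>
    define g where "g = f(n := - B / e)"
    have "0 \<le> (\<Sum>i<Suc n. \<Sum>j<Suc n. g i * h i j * g j)"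
      by (rule Suc.prems(2))
    also have "\<dots> = (\<Sum>i<n. \<Sum>j<n. f i * h i j * f j) + 2 * (- B / e) * B + (- B / e) * e * (- B / e)"
      unfolding Q B_def e_def[symmetric] by (simp add: g_def B_def)
    also have "\<dots> = (\<Sum>i<n. \<Sum>j<n. f i * h i j * f j) - B * B / e"
      by (cases "e = 0") (simp_all add: field_simps)
    also have "B * B / e = (\<Sum>i<n. \<Sum>j<n. f i * (h i n * h j n / e) * f j)"
      by (simp add: B_def sum_product sum_divide_distrib mult_ac)
    also have "(\<Sum>i<n. \<Sum>j<n. f i * h i j * f j) - \<dots> = (\<Sum>i<n. \<Sum>j<n. f i * h' i j * f j)"
      by (simp add: h'_def sum_subtractf[symmetric] algebra_simps)
    finally show ?thesis .
  qed
  have sym': "h' i j = h' j i" if "i < n" "j < n" for i j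
    using Suc.prems(1)[of i j] that by (simp add: h'_def mult.commute)
  have "\<exists>V d. (\<forall>i<n. 0 \<le> d i) \<and> (\<forall>i<n. V i i = 1) \<and> (\<forall>i<n. \<forall>j<i. V i j = 0) \<and>
    (\<forall>i<n. \<forall>j<n. h' i j = (\<Sum>l<n. V i l * d l * V j l))"
    by (rule Suc.IH[OF sym' psd'])
  then obtain V d where "(\<forall>i<n. 0 \<le> d i) \<and> (\<forall>i<n. V i i = 1) \<and> (\<forall>i<n. \<forall>j<i. V i j = 0) \<and>
    (\<forall>i<n. \<forall>j<n. h' i j = (\<Sum>l<n. V i l * d l * V j l))"
    by (elim exE)
  then have V: "\<And>i. i < n \<Longrightarrow> 0 \<le> d i" "\<And>i. i < n \<Longrightarrow> V i i = 1"
    "\<And>i j. i < n \<Longrightarrow> j < i \<Longrightarrow> V i j = 0"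
    "\<And>i j. i < n \<Longrightarrow> j < n \<Longrightarrow> h' i j = (\<Sum>l<n. V i l * d l * V j l)"
    by simp_all
  define V' where "V' = (\<lambda>i l. if i = n then (if l = n then 1 else 0)
    else if l = n then h i n / e else V i l)"
  define d' where "d' = d(n := e)"
  have "h i j = (\<Sum>l<Suc n. V' i l * d' l * V' j l)" if ij: "i < Suc n" "j < Suc n" for i j
  proof -
    \<comment> \<open>The one place where the division by the pivot has to be undone; a zero pivot
      is saved by its zero column.\<close>
    have aux: "h i n / e * e = h i n" if "i < n" for i
      using col0[OF _ that] by (cases "e = 0") auto
    consider "i < n" "j < n" | "i < n" "j = n" | "i = n" "j < n" | "i = n" "j = n"
      using ij by linarith
    then show ?thesis
    proof cases
      case 1
      have "(\<Sum>l<Suc n. V' i l * d' l * V' j l) = h' i j + h i n / e * e * (h j n / e)"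
        using 1 V(4)[of i j] by (simp add: V'_def d'_def)
      also have "\<dots> = h i j"
        unfolding aux[OF 1(1)] by (simp add: h'_def)
      finally show ?thesis by simp
    next
      case 2
      then show ?thesis using aux[of i] by (simp add: V'_def d'_def)
    next
      case 3
      then show ?thesis using aux[of j] sym[of j] by (simp add: V'_def d'_def mult.commute)
    next
      case 4
      then show ?thesis by (simp add: V'_def d'_def e_def)
    qed
  qed
  moreover have "\<forall>i<Suc n. 0 \<le> d' i" "\<forall>i<Suc n. V' i i = 1" "\<forall>i<Suc n. \<forall>j<i. V' i j = 0"
    using V(1-3) e0 by (auto simp: V'_def d'_def less_Suc_eq)
  ultimately show ?case by blast
qed

lemma mult_diagonal_mult_transpose_entry:
  fixes A D :: "'a::comm_ring_1 mat"
  assumes "A \<in> carrier_mat n n" "D \<in> carrier_mat n n" "diagonal_mat D" "i < n" "j < n"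
  shows "(A * D * transpose_mat A) $$ (i,j) = (\<Sum>l<n. A $$ (i,l) * D $$ (l,l) * A $$ (j,l))"
proof -
  have "(A * D) $$ (i,l) = A $$ (i,l) * D $$ (l,l)" if "l < n" for l
  proof -
    have "(A * D) $$ (i,l) = (\<Sum>k<n. A $$ (i,k) * D $$ (k,l))"
      using assms that by (simp add: scalar_prod_def atLeast0LessThan)
    also have "\<dots> = (\<Sum>k<n. if k = l then A $$ (i,l) * D $$ (l,l) else 0)"
      using assms that by (intro sum.cong refl) (auto simp: diagonal_mat_def)
    finally show ?thesis using that by simp
  qed
  moreover have "(B * transpose_mat A) $$ (i,j) = (\<Sum>l<n. B $$ (i,l) * A $$ (j,l))"
    if "B \<in> carrier_mat n n" for B
    using that assms by (simp add: scalar_prod_def atLeast0LessThan)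
  ultimately show ?thesis
    using assms(1,2) by (simp del: index_mult_mat assoc_mult_mat)
qed

lemma ldl_decomp_exists:
  assumes H: "H \<in> carrier_mat n n" "sym_psd H"
  shows "\<exists>U D. ldl_decomp H U D"
proof -
  have "\<exists>V d. (\<forall>i<n. 0 \<le> d i) \<and> (\<forall>i<n. V i i = 1) \<and> (\<forall>i<n. \<forall>j<i. V i j = 0) \<and>
    (\<forall>i<n. \<forall>j<n. H $$ (i,j) = (\<Sum>l<n. V i l * d l * V j l))"
    by (rule psd_form_factorization[OF sym_psdD[OF H]])
  then obtain V d where "(\<forall>i<n. 0 \<le> d i) \<and> (\<forall>i<n. V i i = 1) \<and> (\<forall>i<n. \<forall>j<i. V i j = 0) \<and>
    (\<forall>i<n. \<forall>j<n. H $$ (i,j) = (\<Sum>l<n. V i l * d l * V j l))"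
    by (elim exE)
  then have V: "\<And>i. i < n \<Longrightarrow> 0 \<le> d i" "\<And>i. i < n \<Longrightarrow> V i i = 1"
    "\<And>i j. i < n \<Longrightarrow> j < i \<Longrightarrow> V i j = 0"
    "\<And>i j. i < n \<Longrightarrow> j < n \<Longrightarrow> H $$ (i,j) = (\<Sum>l<n. V i l * d l * V j l)"
    by simp_all
  define U where "U = Matrix.mat n n (\<lambda>(i,j). if i < j then V i j else 0)"
  define D where "D = Matrix.mat n n (\<lambda>(i,j). if i = j then d i else 0)"
  have c: "U + 1\<^sub>m n \<in> carrier_mat n n" "D \<in> carrier_mat n n" "diagonal_mat D"
    by (auto simp: U_def D_def diagonal_mat_def)
  have UV: "(U + 1\<^sub>m n) $$ (i,l) = V i l" if "i < n" "l < n" for i l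
    using that V(2,3) by (auto simp: U_def not_less_iff_gr_or_eq)
  have "H = (U + 1\<^sub>m n) * D * transpose_mat (U + 1\<^sub>m n)"
  proof (rule eq_matI)
    fix i j assume "i < dim_row ((U + 1\<^sub>m n) * D * transpose_mat (U + 1\<^sub>m n))"
      "j < dim_col ((U + 1\<^sub>m n) * D * transpose_mat (U + 1\<^sub>m n))"
    then have ij: "i < n" "j < n" by (auto simp: U_def)
    show "H $$ (i,j) = ((U + 1\<^sub>m n) * D * transpose_mat (U + 1\<^sub>m n)) $$ (i,j)"
      unfolding mult_diagonal_mult_transpose_entry[OF c ij] V(4)[OF ij]
      by (intro sum.cong refl) (simp add: UV ij D_def del: index_add_mat)
  qed (use H in \<open>auto simp: U_def\<close>)
  then have "ldl_decomp H U D"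
    using H V(1) unfolding ldl_decomp_def by (auto simp: U_def D_def diagonal_mat_def Let_def)
  then show ?thesis by blast
qed

text \<open>\<open>ldl_U\<close> keeps only the first component of a chosen pair, so the matching
  pivots are recovered by an existence statement and later results are stated for any such
  \<open>D\<close>.\<close>

lemma ldl_U_decomp:
  assumes "H \<in> carrier_mat n n" "sym_psd H"
  obtains D where "ldl_decomp H (ldl_U H) D"
proof -
  have "\<exists>p. (case p of (U, D) \<Rightarrow> ldl_decomp H U D)"
    using ldl_decomp_exists[OF assms] by auto
  from someI_ex[OF this] show ?thesis
    using that by (cases "SOME (U, D). ldl_decomp H U D") (simp add: ldl_U_def)
qed

lemma ldl_decomp_entry:
  assumes "ldl_decomp H U D" "H \<in> carrier_mat n n" "i < n" "j < n"
  shows "H $$ (i,j) = (\<Sum>l<n. (U + 1\<^sub>m n) $$ (i,l) * D $$ (l,l) * (U + 1\<^sub>m n) $$ (j,l))"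
proof -
  have *: "U + 1\<^sub>m n \<in> carrier_mat n n" "D \<in> carrier_mat n n" "diagonal_mat D"
    "H = (U + 1\<^sub>m n) * D * transpose_mat (U + 1\<^sub>m n)"
    using assms by (auto simp: ldl_decomp_def Let_def)
  show ?thesis
    by (subst *(4)) (rule mult_diagonal_mult_transpose_entry[OF *(1-3) assms(3,4)])
qed

lemma ldl_decomp_upper:
  assumes "ldl_decomp H U D" "H \<in> carrier_mat n n" "i < n" "j < n"
  shows "(U + 1\<^sub>m n) $$ (i,j) = (if i = j then 1 else if i < j then U $$ (i,j) else 0)"
  using assms by (auto simp: ldl_decomp_def Let_def)

lemma ldl_decomp_diag_nonneg:
  assumes "ldl_decomp H U D" "H \<in> carrier_mat n n" "k < n"
  shows "0 \<le> D $$ (k,k)"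
  using assms by (auto simp: ldl_decomp_def Let_def)

text \<open>A diagonal entry of \<open>H\<close> is a sum of squares weighted by the pivots; the
  unit diagonal of \<open>U + I\<close> makes one of the terms the pivot itself.\<close>

lemma ldl_decomp_diag_le:
  assumes "ldl_decomp H U D" "H \<in> carrier_mat n n" "k < n"
  shows "D $$ (k,k) \<le> H $$ (k,k)"
proof -
  let ?t = "\<lambda>l. (U + 1\<^sub>m n) $$ (k,l) * D $$ (l,l) * (U + 1\<^sub>m n) $$ (k,l)"
  have "?t l = ((U + 1\<^sub>m n) $$ (k,l))\<^sup>2 * D $$ (l,l)" for l
    by (simp add: power2_eq_square mult_ac)
  then have "0 \<le> ?t l" if "l < n" for l
    using ldl_decomp_diag_nonneg[OF assms(1,2) that] by (simp only: zero_le_power2 mult_nonneg_nonneg)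
  then have "?t k \<le> (\<Sum>l<n. ?t l)"
    using assms(3) by (intro member_le_sum) (auto simp del: index_add_mat)
  then show ?thesis
    using ldl_decomp_upper[OF assms assms(3)] ldl_decomp_entry[OF assms assms(3)] by simp
qed

lemma ldl_decomp_trace_le:
  assumes "ldl_decomp H U D" "H \<in> carrier_mat n n"
  shows "(\<Sum>k<n. D $$ (k,k)) \<le> mtrace H"
  using assms ldl_decomp_diag_le[OF assms] by (auto simp: mtrace_def intro!: sum_mono)

text \<open>The decomposition of a singular matrix is not unique: columns of \<open>U\<close> belonging to zero
  pivots are arbitrary. For diagonal matrices all other columns vanish.\<close>

lemma ldl_decomp_diagonal_mat:
  assumes ldl: "ldl_decomp H U D" and H: "H \<in> carrier_mat n n" and diag: "diagonal_mat H"
    and "k < n"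
  shows "(\<forall>j<k. U $$ (j,k) * D $$ (k,k) = 0) \<and> D $$ (k,k) = H $$ (k,k)"
  using \<open>k < n\<close>
\<comment> \<open>Induction from the last column backwards: in the expansion of
  \<open>H $$ (j,k)\<close> the terms \<open>l < k\<close> vanish by triangularity and the terms
  \<open>l > k\<close> by the induction hypothesis.\<close>
proof (induction "n - k" arbitrary: k rule: less_induct)
  case less
  let ?V = "U + 1\<^sub>m n"
  have "H $$ (j,k) = ?V $$ (j,k) * D $$ (k,k)" if "j \<le> k" for j
  proof -
    have "?V $$ (j,l) * D $$ (l,l) * ?V $$ (k,l) = (if l = k then ?V $$ (j,k) * D $$ (k,k) else 0)"
      if "l < n" for l
    proof -
      consider "l = k" | "l < k" | "k < l" by linarith
      then show ?thesis
      proof cases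
        case 3
        then have "U $$ (k,l) * D $$ (l,l) = 0"
          using less.hyps[of l] that by (auto simp: diff_less_mono2)
        then show ?thesis
          using ldl_decomp_upper[OF ldl H less.prems that] 3 by auto
      qed (use ldl_decomp_upper[OF ldl H less.prems that] in auto)
    qed
    then have "(\<Sum>l<n. ?V $$ (j,l) * D $$ (l,l) * ?V $$ (k,l))
        = (\<Sum>l<n. if l = k then ?V $$ (j,k) * D $$ (k,k) else 0)"
      by (intro sum.cong) auto
    then show ?thesis
      using ldl_decomp_entry[OF ldl H _ less.prems, of j] less.prems that by simp
  qed
  note e = this
  have "U $$ (j,k) * D $$ (k,k) = 0" if "j < k" for j
    using e[of j] that less.prems ldl_decomp_upper[OF ldl H _ less.prems, of j] diag H
    by (auto simp: diagonal_mat_def)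
  moreover have "D $$ (k,k) = H $$ (k,k)"
    using e[of k] ldl_decomp_upper[OF ldl H less.prems less.prems] by simp
  ultimately show ?case by blast
qed

subsection \<open>Spectrum and trace\<close>

lemma mtrace_mult_commute:
  assumes "A \<in> carrier_mat n n" "B \<in> carrier_mat n n"
  shows "mtrace (A * B) = mtrace (B * A)"
proof -
  have "mtrace (A * B) = (\<Sum>i<n. \<Sum>j<n. A $$ (i,j) * B $$ (j,i))"
    using assms by (auto simp: mtrace_def scalar_prod_def atLeast0LessThan)
  also have "\<dots> = (\<Sum>j<n. \<Sum>i<n. A $$ (i,j) * B $$ (j,i))"
    by (rule sum.swap)
  also have "\<dots> = mtrace (B * A)"
    using assms by (auto simp: mtrace_def scalar_prod_def atLeast0LessThan mult.commute)
  finally show ?thesis .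
qed

text \<open>A Schur decomposition makes \<open>A\<close> similar to a matrix with diagonal
  \<open>es\<close>, and similarity preserves the trace.\<close>

lemma mtrace_eq_sum_list_eigenvalues:
  assumes A: "A \<in> carrier_mat n n" and c: "char_poly A = (\<Prod>e\<leftarrow>es. [:- e, 1:])"
  shows "mtrace A = sum_list es"
proof -
  obtain B P Q where BPQ: "schur_decomposition A es = (B,P,Q)"
    by (cases "schur_decomposition A es") auto
  from schur_decomposition[OF A c BPQ]
  have sim: "similar_mat_wit A B P Q" and d: "diag_mat B = es" by auto
  note s = similar_mat_witD2[OF A sim]
  have "mtrace A = mtrace (P * (B * Q))"
    using s by (metis assoc_mult_mat)
  also have "\<dots> = mtrace (B * Q * P)"
    using s by (intro mtrace_mult_commute) auto
  also have "B * Q * P = B"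
    using s by (metis assoc_mult_mat right_mult_one_mat)
  also have "mtrace B = sum_list es"
    unfolding d[symmetric] by (simp add: mtrace_def diag_mat_def sum_list_sum_nth atLeast0LessThan)
  finally show ?thesis .
qed

text \<open>Split the eigenvector as \<open>x + i y\<close>. Symmetry makes the two mixed values of
  the form equal, and their difference is \<open>Im a\<close> times the squared norm; the sum of the
  values at \<open>x\<close> and at \<open>y\<close> is \<open>Re a\<close> times the squared
  norm.\<close>

lemma sym_psd_complex_eigenvalue:
  assumes H: "H \<in> carrier_mat n n" "sym_psd H"
    and ev: "eigenvalue (map_mat complex_of_real H) a"
  shows "Im a = 0 \<and> 0 \<le> Re a"
proof -
  obtain v where v: "v \<in> carrier_vec n" "v \<noteq> 0\<^sub>v n"
    "map_mat complex_of_real H *\<^sub>v v = a \<cdot>\<^sub>v v"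
    using ev H by (auto simp: eigenvalue_def eigenvector_def)
  define x where "x = (\<lambda>i. Re (v $ i))"
  define y where "y = (\<lambda>i. Im (v $ i))"
  have "(\<Sum>j<n. complex_of_real (H $$ (i,j)) * v $ j) = a * v $ i" if "i < n" for i
  proof -
    have "(map_mat complex_of_real H *\<^sub>v v) $ i = a * v $ i"
      using v that by simp
    then show ?thesis
      using H(1) v(1) that by (simp add: scalar_prod_def atLeast0LessThan)
  qed
  note e = this
  have Hx: "(\<Sum>j<n. H $$ (i,j) * x j) = Re a * x i - Im a * y i"
    and Hy: "(\<Sum>j<n. H $$ (i,j) * y j) = Im a * x i + Re a * y i" if "i < n" for i
    using arg_cong[OF e[OF that], of Re] arg_cong[OF e[OF that], of Im]
    by (simp_all add: x_def y_def)
  define S where "S = (\<Sum>i<n. (x i)\<^sup>2 + (y i)\<^sup>2)"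
  have "0 < S"
  proof -
    obtain i where "i < n" "v $ i \<noteq> 0"
      using v(1,2) by (metis carrier_vecD eq_vecI index_zero_vec)
    then have "0 < (x i)\<^sup>2 + (y i)\<^sup>2"
      by (simp add: x_def y_def complex_eq_iff sum_power2_gt_zero_iff)
    also have "\<dots> \<le> S"
      unfolding S_def using \<open>i < n\<close> by (intro member_le_sum) auto
    finally show ?thesis .
  qed
  have dx: "(\<Sum>i<n. \<Sum>j<n. f i * H $$ (i,j) * x j) = (\<Sum>i<n. f i * (Re a * x i - Im a * y i))" for f
    by (intro sum.cong refl) (simp add: Hx[symmetric] sum_distrib_left mult.assoc)
  have dy: "(\<Sum>i<n. \<Sum>j<n. f i * H $$ (i,j) * y j) = (\<Sum>i<n. f i * (Im a * x i + Re a * y i))" for f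
    by (intro sum.cong refl) (simp add: Hy[symmetric] sum_distrib_left mult.assoc)
  have "(\<Sum>i<n. \<Sum>j<n. x i * H $$ (i,j) * y j) = (\<Sum>j<n. \<Sum>i<n. x i * H $$ (i,j) * y j)"
    by (rule sum.swap)
  also have "\<dots> = (\<Sum>i<n. \<Sum>j<n. y i * H $$ (i,j) * x j)"
    using sym_psdD(1)[OF H] by (auto intro!: sum.cong simp: mult_ac)
  finally have "(\<Sum>i<n. x i * (Im a * x i + Re a * y i)) - (\<Sum>i<n. y i * (Re a * x i - Im a * y i)) = 0"
    unfolding dx dy by simp
  also have "(\<Sum>i<n. x i * (Im a * x i + Re a * y i)) - (\<Sum>i<n. y i * (Re a * x i - Im a * y i)) = Im a * S"
    unfolding S_def sum_distrib_left sum_subtractf[symmetric]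
    by (intro sum.cong refl) (simp add: power2_eq_square algebra_simps)
  finally have im: "Im a = 0"
    using \<open>0 < S\<close> by simp
  have "0 \<le> (\<Sum>i<n. \<Sum>j<n. x i * H $$ (i,j) * x j) + (\<Sum>i<n. \<Sum>j<n. y i * H $$ (i,j) * y j)"
    using sym_psdD(2)[OF H] by (intro add_nonneg_nonneg)
  also have "\<dots> = Re a * S"
    unfolding dx dy S_def sum_distrib_left sum.distrib[symmetric]
    by (intro sum.cong refl) (simp add: im power2_eq_square algebra_simps)
  finally show ?thesis
    using im \<open>0 < S\<close> by (simp add: zero_le_mult_iff)
qed

text \<open>The polynomial splits over the complex numbers, its roots are real and nonnegative, and
  the coefficient embedding is injective, so the factorization descends to the reals.\<close>

lemma sym_psd_char_poly_factorized:
  assumes H: "H \<in> carrier_mat n n" "sym_psd H"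
  obtains es where "char_poly H = (\<Prod>e\<leftarrow>es. [:- e, 1:])" "length es = n" "\<forall>e\<in>set es. 0 \<le> e"
proof -
  let ?H = "map_mat complex_of_real H"
  have Hc: "?H \<in> carrier_mat n n" using H by simp
  obtain as where as: "char_poly ?H = (\<Prod>a\<leftarrow>as. [:- a, 1:])" "length as = n"
    using char_poly_factorized[OF Hc] by blast
  have ev: "Im a = 0 \<and> 0 \<le> Re a" if "a \<in> set as" for a
  proof -
    have "poly (char_poly ?H) a = 0"
      unfolding as(1) using that by (rule linear_poly_root)
    then show ?thesis
      using eigenvalue_root_char_poly[OF Hc] sym_psd_complex_eigenvalue[OF H] by blast
  qed
  define es where "es = map Re as"
  have as_es: "as = map complex_of_real es"
    using ev by (auto simp: es_def map_idI complex_eq_iff intro!: map_idI[symmetric])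
  interpret rp: map_poly_inj_idom_hom complex_of_real ..
  have "map_poly complex_of_real (char_poly H) = map_poly complex_of_real (\<Prod>e\<leftarrow>es. [:- e, 1:])"
  proof -
    have "map_poly complex_of_real (char_poly H) = char_poly ?H"
      by (simp add: of_real_hom.char_poly_hom[OF H(1)])
    also have "\<dots> = map_poly complex_of_real (\<Prod>e\<leftarrow>es. [:- e, 1:])"
      unfolding as(1) as_es
      by (simp add: rp.hom_prod_list o_def del: rp.prod_list_map_hom)
    finally show ?thesis .
  qed
  then have "char_poly H = (\<Prod>e\<leftarrow>es. [:- e, 1:])"
    by simp
  moreover have "length es = n" "\<forall>e\<in>set es. 0 \<le> e"
    using as(2) ev by (auto simp: es_def)
  ultimately show ?thesis by (rule that)
qed

text \<open>Translates \<open>eig_mult\<close> into multisets of roots, so that equal multiplicities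
  give equal sums of eigenvalues.\<close>

lemma order_prod_linear_factors:
  fixes es :: "'a::idom list"
  shows "Polynomial.order a (\<Prod>e\<leftarrow>es. [:- e, 1:]) = count (mset es) a"
proof (induction es)
  case (Cons e es)
  have "Polynomial.order a ([:- e, 1:] * (\<Prod>e\<leftarrow>es. [:- e, 1:])) = Polynomial.order a [:- e, 1:] + Polynomial.order a (\<Prod>e\<leftarrow>es. [:- e, 1:])"
    by (rule order_mult) (simp only: mult_eq_0_iff prod_list_zero_iff, auto)
  then show ?case
    using Cons by (simp add: order_linear')
qed simp

lemma same_spectrum_psd_mtrace:
  assumes H: "H \<in> carrier_mat n n" "sym_psd H" and Ht: "Ht \<in> same_spectrum_psd H"
  shows "Ht \<in> carrier_mat n n" "sym_psd Ht" "mtrace Ht = mtrace H"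
proof -
  show Htc: "Ht \<in> carrier_mat n n" and Htp: "sym_psd Ht"
    using Ht H by (auto simp: same_spectrum_psd_def sym_psd_def)
  obtain es where es: "char_poly H = (\<Prod>e\<leftarrow>es. [:- e, 1:])"
    using sym_psd_char_poly_factorized[OF H] by blast
  obtain es' where es': "char_poly Ht = (\<Prod>e\<leftarrow>es'. [:- e, 1:])"
    using sym_psd_char_poly_factorized[OF Htc Htp] by blast
  have "mset es' = mset es"
    using Ht by (intro multiset_eqI)
      (simp add: same_spectrum_psd_def eig_mult_def es es' order_prod_linear_factors)
  then have "sum_list es' = sum_list es"
    by (metis sum_mset_sum_list)
  then show "mtrace Ht = mtrace H"
    using mtrace_eq_sum_list_eigenvalues[OF H(1) es] mtrace_eq_sum_list_eigenvalues[OF Htc es'] by simp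
qed

text \<open>Supplies the matrix at which the suprema over \<open>same_spectrum_psd H\<close> are
  attained.\<close>

lemma diagonal_mat_same_spectrum:
  assumes H: "H \<in> carrier_mat n n" "sym_psd H"
  obtains L where "L \<in> same_spectrum_psd H" "diagonal_mat L"
proof -
  obtain es where es: "char_poly H = (\<Prod>e\<leftarrow>es. [:- e, 1:])" "length es = n" "\<forall>e\<in>set es. 0 \<le> e"
    using sym_psd_char_poly_factorized[OF H] by blast
  define L where "L = Matrix.mat n n (\<lambda>(i,j). if i = j then es ! i else 0)"
  have L: "L \<in> carrier_mat n n" "diagonal_mat L"
    by (auto simp: L_def diagonal_mat_def)
  have "diag_mat L = es"
    using es(2) by (auto simp: diag_mat_def L_def intro: nth_equalityI)
  moreover have "upper_triangular L"
    by (auto simp: L_def upper_triangular_def)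
  ultimately have cp: "char_poly L = char_poly H"
    using char_poly_upper_triangular[OF L(1)] es(1) by simp
  have "0 \<le> x \<bullet> (L *\<^sub>v x)" if "x \<in> carrier_vec n" for x
  proof -
    have "(L *\<^sub>v x) $ i = es ! i * x $ i" if "i < n" for i
    proof -
      have "(L *\<^sub>v x) $ i = (\<Sum>j<n. L $$ (i,j) * x $ j)"
        using that \<open>x \<in> carrier_vec n\<close> L(1) by (simp add: scalar_prod_def atLeast0LessThan)
      also have "\<dots> = (\<Sum>j<n. if j = i then es ! i * x $ i else 0)"
        using that by (intro sum.cong) (auto simp: L_def)
      finally show ?thesis using that by simp
    qed
    then have "x \<bullet> (L *\<^sub>v x) = (\<Sum>i<n. es ! i * (x $ i)\<^sup>2)"
      using L(1) by (auto simp: real_scalar_prod_sum power2_eq_square intro!: sum.cong)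
    also have "0 \<le> \<dots>"
      using es(2,3) by (intro sum_nonneg mult_nonneg_nonneg) auto
    finally show ?thesis .
  qed
  moreover have "transpose_mat L = L"
    by (rule eq_matI) (auto simp: L_def)
  ultimately have "sym_psd L"
    using L(1) by (auto simp: sym_psd_def)
  then have "L \<in> same_spectrum_psd H"
    using H L(1) cp by (auto simp: same_spectrum_psd_def eig_mult_def)
  then show ?thesis using that L(2) by blast
qed

subsection \<open>The proxy loss of LDLQ\<close>

lemma proxy_eq_sum:
  assumes "X \<in> carrier_mat m n" "W \<in> carrier_mat m n" "H \<in> carrier_mat n n"
  shows "proxy X W H = (\<Sum>i<m. \<Sum>k<n. \<Sum>l<n.
    (X $$ (i,k) - W $$ (i,k)) * H $$ (k,l) * (X $$ (i,l) - W $$ (i,l)))"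
proof -
  let ?E = "X - W"
  have "proxy X W H = (\<Sum>i<m. \<Sum>l<n. (\<Sum>k<n. ?E $$ (i,k) * H $$ (k,l)) * ?E $$ (i,l))"
    using assms by (auto simp: proxy_def mtrace_def scalar_prod_def atLeast0LessThan intro!: sum.cong)
  also have "\<dots> = (\<Sum>i<m. \<Sum>k<n. \<Sum>l<n. ?E $$ (i,k) * H $$ (k,l) * ?E $$ (i,l))"
    unfolding sum_distrib_right by (intro sum.cong refl sum.swap)
  also have "\<dots> = (\<Sum>i<m. \<Sum>k<n. \<Sum>l<n.
    (X $$ (i,k) - W $$ (i,k)) * H $$ (k,l) * (X $$ (i,l) - W $$ (i,l)))"
    using assms by (intro sum.cong refl) auto
  finally show ?thesis .
qed

text \<open>\<open>ldlq_row\<close> only appends, so entry \<open>k\<close> is final after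
  \<open>k + 1\<close> steps. Indexing by \<open>k\<close> replaces the growing list by a
  function.\<close>

definition ldlq_entry :: "(nat \<Rightarrow> real \<Rightarrow> real) \<Rightarrow> (nat \<Rightarrow> real) \<Rightarrow> real mat \<Rightarrow> nat \<Rightarrow> real" where
  "ldlq_entry Q w U k = ldlq_row Q w U (Suc k) ! k"

text \<open>The number that is actually rounded in column \<open>k\<close>. It is named separately
  because the loss is governed by its rounding error and not by the distance to
  \<open>w k\<close>.\<close>

definition ldlq_target :: "(nat \<Rightarrow> real \<Rightarrow> real) \<Rightarrow> (nat \<Rightarrow> real) \<Rightarrow> real mat \<Rightarrow> nat \<Rightarrow> real" where
  "ldlq_target Q w U k = w k + (\<Sum>j<k. (w j - ldlq_entry Q w U j) * U $$ (j,k))"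

lemma length_ldlq_row [simp]: "length (ldlq_row Q w U k) = k"
  by (induction k) (simp_all add: Let_def)

lemma ldlq_row_nth: "k < n \<Longrightarrow> ldlq_row Q w U n ! k = ldlq_entry Q w U k"
proof (induction n)
  case (Suc n)
  then show ?case
    by (cases "k = n") (simp_all add: ldlq_entry_def Let_def nth_append)
qed simp

lemma ldlq_entry_eq: "ldlq_entry Q w U k = Q k (ldlq_target Q w U k)"
proof -
  have "ldlq_entry Q w U k = Q k (w k + (\<Sum>j<k. (w j - ldlq_row Q w U k ! j) * U $$ (j,k)))"
    unfolding ldlq_entry_def by (simp add: Let_def nth_append)
  also have "(\<Sum>j<k. (w j - ldlq_row Q w U k ! j) * U $$ (j,k)) = (\<Sum>j<k. (w j - ldlq_entry Q w U j) * U $$ (j,k))"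
    by (intro sum.cong refl) (simp add: ldlq_row_nth)
  finally show ?thesis by (simp add: ldlq_target_def)
qed

text \<open>Writing \<open>e = What - W\<close>, the error at the rounding step is \<open>e (U + I)\<close>, so the triangular
  factors of \<open>H\<close> are absorbed and only the pivots remain.\<close>

lemma proxy_LDLQ:
  fixes Q :: "real \<Rightarrow> real \<Rightarrow> real" and u :: "nat \<times> nat \<Rightarrow> real"
  assumes ldl: "ldl_decomp H (ldl_U H) D" and H: "H \<in> carrier_mat n n"
    and W: "W \<in> carrier_mat m n"
  defines "z \<equiv> \<lambda>i. ldlq_target (\<lambda>k. Q (u (i,k))) (\<lambda>j. W $$ (i,j)) (ldl_U H)"
  shows "proxy (LDLQ Q W H u) W H = (\<Sum>i<m. \<Sum>k<n. D $$ (k,k) * (Q (u (i,k)) (z i k) - z i k)\<^sup>2)"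
proof -
  let ?U = "ldl_U H"
  let ?V = "?U + 1\<^sub>m n"
  define X where "X = (\<lambda>i. ldlq_entry (\<lambda>k. Q (u (i,k))) (\<lambda>j. W $$ (i,j)) ?U)"
  have LX: "LDLQ Q W H u \<in> carrier_mat m n"
    using W by (simp add: LDLQ_def Let_def)
  have LXe: "LDLQ Q W H u $$ (i,k) = X i k" if "i < m" "k < n" for i k
    using W that by (simp add: LDLQ_def Let_def ldlq_row_nth X_def)
  define e where "e = (\<lambda>i k. X i k - W $$ (i,k))"
  have err: "(\<Sum>k<n. e i k * ?V $$ (k,l)) = Q (u (i,l)) (z i l) - z i l" if l: "l < n" for i l
  proof -
    have "(\<Sum>k<n. e i k * ?V $$ (k,l)) = (\<Sum>k<Suc l. e i k * ?V $$ (k,l))"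
      using l ldl_decomp_upper[OF ldl H _ l] by (intro sum.mono_neutral_right) (auto simp del: index_add_mat)
    also have "\<dots> = (\<Sum>k<l. e i k * ?U $$ (k,l)) + e i l"
      using l ldl_decomp_upper[OF ldl H _ l] by simp
    also have "(\<Sum>k<l. e i k * ?U $$ (k,l)) = W $$ (i,l) - z i l"
      by (simp add: z_def ldlq_target_def e_def X_def sum_negf[symmetric] algebra_simps)
    also have "e i l = Q (u (i,l)) (z i l) - W $$ (i,l)"
      unfolding e_def X_def ldlq_entry_eq z_def by simp
    finally show ?thesis by simp
  qed
  have "proxy (LDLQ Q W H u) W H = (\<Sum>i<m. \<Sum>k<n. \<Sum>l<n. e i k * H $$ (k,l) * e i l)"
    unfolding proxy_eq_sum[OF LX W H] by (intro sum.cong refl) (simp add: LXe e_def)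
  also have "\<dots> = (\<Sum>i<m. \<Sum>k<n. D $$ (k,k) * (Q (u (i,k)) (z i k) - z i k)\<^sup>2)"
  proof (rule sum.cong[OF refl])
    fix i
    have "(\<Sum>k<n. \<Sum>l<n. e i k * H $$ (k,l) * e i l)
        = (\<Sum>k<n. \<Sum>l<n. \<Sum>p<n. D $$ (p,p) * ((e i k * ?V $$ (k,p)) * (e i l * ?V $$ (l,p))))"
      by (intro sum.cong refl)
        (simp add: ldl_decomp_entry[OF ldl H] sum_distrib_left sum_distrib_right mult_ac)
    also have "\<dots> = (\<Sum>k<n. \<Sum>p<n. \<Sum>l<n. D $$ (p,p) * ((e i k * ?V $$ (k,p)) * (e i l * ?V $$ (l,p))))"
      by (intro sum.cong refl sum.swap)
    also have "\<dots> = (\<Sum>p<n. \<Sum>k<n. \<Sum>l<n. D $$ (p,p) * ((e i k * ?V $$ (k,p)) * (e i l * ?V $$ (l,p))))"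
      by (rule sum.swap)
    also have "\<dots> = (\<Sum>p<n. D $$ (p,p) * (\<Sum>k<n. e i k * ?V $$ (k,p))\<^sup>2)"
      unfolding power2_eq_square sum_product unfolding sum_distrib_left ..
    also have "\<dots> = (\<Sum>k<n. D $$ (k,k) * (Q (u (i,k)) (z i k) - z i k)\<^sup>2)"
      by (intro sum.cong refl) (simp add: err del: index_add_mat)
    finally show "(\<Sum>k<n. \<Sum>l<n. e i k * H $$ (k,l) * e i l)
      = (\<Sum>k<n. D $$ (k,k) * (Q (u (i,k)) (z i k) - z i k)\<^sup>2)" .
  qed
  finally show ?thesis .
qed

lemma proxy_entrywise:
  assumes "W \<in> carrier_mat m n" "H \<in> carrier_mat n n"
  shows "proxy (entrywise Q W H u) W H = (\<Sum>i<m. \<Sum>k<n. \<Sum>l<n.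
    (Q (u (i,k)) (W $$ (i,k)) - W $$ (i,k)) * H $$ (k,l) * (Q (u (i,l)) (W $$ (i,l)) - W $$ (i,l)))"
proof -
  have "entrywise Q W H u \<in> carrier_mat m n"
    using assms by (simp add: entrywise_def)
  from proxy_eq_sum[OF this assms] show ?thesis
    using assms by (simp add: entrywise_def)
qed

text \<open>Causality of LDLQ. The bounds differ on purpose: weight \<open>k\<close> enters its own
  target, while the rounding at \<open>k\<close> does not, so the target is independent of the
  random number used there.\<close>

lemma ldlq_target_cong:
  assumes "\<And>j. j \<le> k \<Longrightarrow> w j = w' j" "\<And>j. j < k \<Longrightarrow> Q j = Q' j"
  shows "ldlq_target Q w U k = ldlq_target Q' w' U k"
  using assms
proof (induction k rule: less_induct)
  case (less k)
  have "ldlq_entry Q w U j = ldlq_entry Q' w' U j" if "j < k" for j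
    using less.IH[OF that] less.prems that by (simp add: ldlq_entry_eq)
  then show ?case
    using less.prems by (simp add: ldlq_target_def)
qed

subsection \<open>Integration over the unit cube\<close>

lemma sets_unif01 [measurable_cong, simp]: "sets unif01 = sets borel"
  by (simp add: unif01_def)

lemma space_unif01 [simp]: "space unif01 = UNIV"
  by (simp add: unif01_def)

interpretation unif01: prob_space unif01
  unfolding unif01_def by (rule prob_space_uniform_measure) auto

interpretation unif01_product: product_sigma_finite "\<lambda>_. unif01"
  by unfold_locales

lemma prob_space_unif_cube: "prob_space (unif_cube m n)"
  unfolding unif_cube_def by (rule prob_space_PiM) (rule unif01.prob_space_axioms)

interpretation unif_cube: prob_space "unif_cube m n" for m n
  by (rule prob_space_unif_cube)

interpretation unif_cube_pair: pair_prob_space "unif_cube m n" "unif_cube m n" for m n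
  by unfold_locales

interpretation unif01_pair: pair_prob_space unif01 unif01
  by unfold_locales

text \<open>Removing the right endpoint matters because \<open>frac z = z\<close> fails at
  1.\<close>

lemma AE_unif01: "AE x in unif01. 0 \<le> x \<and> x < 1"
proof -
  have "AE x in lborel. x \<in> {0..1} \<longrightarrow> 0 \<le> x \<and> x < (1::real)"
    using AE_lborel_singleton[of "1::real"] by eventually_elim auto
  then show ?thesis
    unfolding unif01_def by (intro AE_uniform_measureI) auto
qed

lemma integral_unif01_cong:
  fixes f g :: "real \<Rightarrow> real"
  assumes "f \<in> borel_measurable borel" "g \<in> borel_measurable borel"
    and "\<And>x. 0 \<le> x \<Longrightarrow> x < 1 \<Longrightarrow> f x = g x"
  shows "(\<integral>x. f x \<partial>unif01) = (\<integral>x. g x \<partial>unif01)"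
proof (rule integral_cong_AE)
  show "AE x in unif01. f x = g x"
    using AE_unif01 by eventually_elim (use assms(3) in auto)
qed (use assms in measurable)

lemma integral_unif01:
  fixes f :: "real \<Rightarrow> real"
  assumes [measurable]: "f \<in> borel_measurable borel"
  shows "(\<integral>x. f x \<partial>unif01) = (\<integral>x. f x * indicator {0..1} x \<partial>lborel)"
proof -
  have "unif01 = density lborel (\<lambda>x. ennreal (indicator {0..1} x))"
    unfolding unif01_def uniform_measure_def 
    by (intro density_cong) (auto simp: indicator_def divide_ennreal_def)
  then have "(\<integral>x. f x \<partial>unif01) = (\<integral>x. f x \<partial>density lborel (\<lambda>x. ennreal (indicator {0..1} x)))"
    by (rule arg_cong)
  also have "\<dots> = (\<integral>x. indicator {0..1} x *\<^sub>R f x \<partial>lborel)"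
    by (rule integral_density) auto
  finally show ?thesis
    by (simp add: mult.commute)
qed

lemma integral_unif01_halfopen:
  fixes f :: "real \<Rightarrow> real"
  assumes [measurable]: "f \<in> borel_measurable borel"
  shows "(\<integral>x. f x \<partial>unif01) = (\<integral>x. f x * indicator {0..<1} x \<partial>lborel)"
  unfolding integral_unif01[OF assms]
proof (rule integral_cong_AE)
  show "AE x in lborel. f x * indicator {0..1} x = f x * indicator {0..<1} x"
    using AE_lborel_singleton[of "1::real"] by eventually_elim (auto simp: indicator_def)
qed measurable

lemma integral_unif01_FTC:
  fixes f F :: "real \<Rightarrow> real"
  assumes "f \<in> borel_measurable borel" "\<And>x. DERIV F x :> f x" "\<And>x. isCont f x"
  shows "(\<integral>x. f x \<partial>unif01) = F 1 - F 0"
  unfolding integral_unif01[OF assms(1)] by (rule integral_FTC_Icc_real) (use assms in auto)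

text \<open>Translation invariance on the circle: reduce the shift to its fractional part
  \<open>b\<close>, cut \<open>[b, 1 + b)\<close> at 1 and move the upper piece back by one period.
  Half-open intervals fit together exactly.\<close>

lemma integral_unif01_shift:
  fixes h :: "real \<Rightarrow> real"
  assumes [measurable]: "h \<in> borel_measurable borel"
    and per: "\<And>x. h (x + 1) = h x" and bnd: "\<And>x. \<bar>h x\<bar> \<le> B"
  shows "(\<integral>y. h (y + c) \<partial>unif01) = (\<integral>y. h y \<partial>unif01)"
proof -
  have nat_shift: "h (x + real k) = h x" for x k
  proof (induction k)
    case (Suc k)
    then show ?case using per[of "x + real k"] by (simp add: add_ac)
  qed simp
  have int_shift: "h (x + of_int k) = h x" for x k
  proof (cases "0 \<le> k")
    case True
    then show ?thesis using nat_shift[of x "nat k"] by simp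
  next
    case False
    then show ?thesis using nat_shift[of "x + of_int k" "nat (- k)"] by simp
  qed
  define b where "b = frac c"
  have b: "0 \<le> b" "b < 1" by (auto simp: b_def frac_lt_1)
  have hb: "h (y + c) = h (y + b)" for y
    using int_shift[of "y + b" "\<lfloor>c\<rfloor>"] by (simp add: b_def frac_def)
  have int: "integrable lborel (\<lambda>x. h x * indicator {p..<q} x)" for p q
  proof (rule Bochner_Integration.integrable_bound)
    have "emeasure lborel {p..<q} < \<infinity>"
      by (intro emeasure_bounded_finite bounded_subset[OF bounded_closed_interval[of p q]]) auto
    then show "integrable lborel (\<lambda>x. B * indicator {p..<q} x :: real)"
      by (intro integrable_mult_right integrable_real_indicator) auto
    show "AE x in lborel. norm (h x * indicator {p..<q} x) \<le> norm (B * indicator {p..<q} x :: real)"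
      using order_trans[OF bnd abs_ge_self] by (intro AE_I2) (auto simp: indicator_def)
  qed measurable
  let ?I = "\<lambda>p q. \<integral>x. h x * indicator {p..<q} x \<partial>lborel"
  have split: "?I p r = ?I p q + ?I q r" if "p \<le> q" "q \<le> r" for p q r
  proof -
    have "?I p r = (\<integral>x. h x * indicator {p..<q} x + h x * indicator {q..<r} x \<partial>lborel)"
      using that by (intro Bochner_Integration.integral_cong refl) (auto simp: indicator_def)
    also have "\<dots> = ?I p q + ?I q r"
      by (intro Bochner_Integration.integral_add int)
    finally show ?thesis .
  qed
  have shift: "?I (p + t) (q + t) = (\<integral>x. h (x + t) * indicator {p..<q} x \<partial>lborel)" for p q t
  proof -
    have "?I (p + t) (q + t) = (\<integral>x. h (t + 1 * x) * indicator {p + t..<q + t} (t + 1 * x) \<partial>lborel)"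
      by (subst lborel_integral_real_affine[of 1 _ t]) auto
    also have "\<dots> = (\<integral>x. h (x + t) * indicator {p..<q} x \<partial>lborel)"
      by (intro Bochner_Integration.integral_cong refl) (auto simp: indicator_def add.commute)
    finally show ?thesis .
  qed
  have "(\<integral>y. h (y + c) \<partial>unif01) = (\<integral>x. h (x + b) * indicator {0..<1} x \<partial>lborel)"
    unfolding hb by (rule integral_unif01_halfopen) measurable
  also have "\<dots> = ?I b (1 + b)"
    using shift[of 0 b 1] by simp
  also have "\<dots> = ?I b 1 + ?I (0 + 1) (b + 1)"
    using split[of b 1 "1 + b"] b by (simp add: add.commute)
  also have "?I (0 + 1) (b + 1) = ?I 0 b"
    unfolding shift per ..
  also have "?I b 1 + ?I 0 b = ?I 0 1"
    using split[of 0 b 1] b by simp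
  also have "\<dots> = (\<integral>y. h y \<partial>unif01)"
    by (rule integral_unif01_halfopen[symmetric]) measurable
  finally show ?thesis .
qed

lemma unif_cube_component:
  assumes "i < m" "k < n"
  shows "(\<lambda>x. x (i,k)) \<in> borel_measurable (unif_cube m n)"
proof -
  have "(\<lambda>x. x (i,k)) \<in> measurable (unif_cube m n) unif01"
    unfolding unif_cube_def using assms by (intro measurable_component_singleton) auto
  then show ?thesis by (simp cong: measurable_cong_sets)
qed

text \<open>Fubini in the form used for conditioning: one coordinate is integrated while all others
  are frozen.\<close>

lemma integral_unif_cube_component_first:
  fixes F :: "(nat \<times> nat \<Rightarrow> real) \<Rightarrow> real"
  assumes F: "integrable (unif_cube m n) F" and p: "p \<in> {0..<m} \<times> {0..<n}"
  shows "(\<integral>x. F x \<partial>unif_cube m n) =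
    (\<integral>x. (\<integral>y. F (x(p := y)) \<partial>unif01) \<partial>PiM ({0..<m} \<times> {0..<n} - {p}) (\<lambda>_. unif01))"
proof -
  let ?I = "{0..<m} \<times> {0..<n} - {p}"
  have I: "insert p ?I = {0..<m} \<times> {0..<n}" using p by auto
  show ?thesis
    using unif01_product.product_integral_insert[of ?I p F] F
    unfolding unif_cube_def I by simp
qed

lemma integral_unif_cube_eq_const:
  fixes F :: "(nat \<times> nat \<Rightarrow> real) \<Rightarrow> real"
  assumes "integrable (unif_cube m n) F" "p \<in> {0..<m} \<times> {0..<n}"
    and "\<And>x. (\<integral>y. F (x(p := y)) \<partial>unif01) = C"
  shows "(\<integral>x. F x \<partial>unif_cube m n) = C"
proof -
  interpret P: prob_space "PiM ({0..<m} \<times> {0..<n} - {p}) (\<lambda>_. unif01)"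
    by (rule prob_space_PiM) (rule unif01.prob_space_axioms)
  show ?thesis
    unfolding integral_unif_cube_component_first[OF assms(1,2)] assms(3) by (simp add: P.prob_space)
qed

lemma integral_unif_cube_le_const:
  fixes F :: "(nat \<times> nat \<Rightarrow> real) \<Rightarrow> real"
  assumes "integrable (unif_cube m n) F" "p \<in> {0..<m} \<times> {0..<n}"
    and le: "\<And>x. (\<integral>y. F (x(p := y)) \<partial>unif01) \<le> C" and "0 \<le> C"
  shows "(\<integral>x. F x \<partial>unif_cube m n) \<le> C"
proof -
  let ?P = "PiM ({0..<m} \<times> {0..<n} - {p}) (\<lambda>_. unif01)"
  interpret P: prob_space ?P
    by (rule prob_space_PiM) (rule unif01.prob_space_axioms)
  show ?thesis
    unfolding integral_unif_cube_component_first[OF assms(1,2)]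
  proof (cases "integrable ?P (\<lambda>x. \<integral>y. F (x(p := y)) \<partial>unif01)")
    case True
    then show "(\<integral>x. (\<integral>y. F (x(p := y)) \<partial>unif01) \<partial>?P) \<le> C"
      using le by (intro P.integral_le_const) auto
  next
    \<comment> \<open>A non-integrable function has integral 0 by convention, so
      \<open>0 \<le> C\<close> settles this case.\<close>
    case False
    then show "(\<integral>x. (\<integral>y. F (x(p := y)) \<partial>unif01) \<partial>?P) \<le> C"
      using \<open>0 \<le> C\<close> by (simp add: not_integrable_integral_eq)
  qed
qed

lemma integral_unif_cube_component:
  fixes f :: "real \<Rightarrow> real"
  assumes [measurable]: "f \<in> borel_measurable borel" and bnd: "\<And>x. \<bar>f x\<bar> \<le> B" and ik: "i < m" "k < n"
  shows "integrable (unif_cube m n) (\<lambda>x. f (x (i,k)))"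
    and "(\<integral>x. f (x (i,k)) \<partial>unif_cube m n) = (\<integral>y. f y \<partial>unif01)"
proof -
  show *: "integrable (unif_cube m n) (\<lambda>x. f (x (i,k)))"
    using bnd measurable_compose[OF unif_cube_component[OF ik] assms(1)]
    by (intro unif_cube.integrable_const_bound[where B = B]) auto
  show "(\<integral>x. f (x (i,k)) \<partial>unif_cube m n) = (\<integral>y. f y \<partial>unif01)"
    using ik by (intro integral_unif_cube_eq_const[OF *, of "(i,k)"]) auto
qed

lemma integral_weighted_sum:
  fixes f :: "'i \<Rightarrow> 'j \<Rightarrow> 'a \<Rightarrow> real"
  assumes "\<And>i k. i \<in> I \<Longrightarrow> k \<in> K \<Longrightarrow> integrable M (f i k)"
  shows "(\<integral>x. (\<Sum>i\<in>I. \<Sum>k\<in>K. c i k * f i k x) \<partial>M) = (\<Sum>i\<in>I. \<Sum>k\<in>K. c i k * (\<integral>x. f i k x \<partial>M))"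
  by (rule has_bochner_integral_integral_eq)
    (intro has_bochner_integral_sum has_bochner_integral_mult_right has_bochner_integral_integrable assms)

text \<open>The off-diagonal entries of \<open>H\<close> do not contribute, by independence and centering.\<close>

lemma integral_unif_cube_quadratic_form:
  fixes a :: "nat \<times> nat \<Rightarrow> real \<Rightarrow> real" and h :: "nat \<Rightarrow> nat \<Rightarrow> real"
  assumes [measurable]: "\<And>p. a p \<in> borel_measurable borel"
    and bnd: "\<And>p y. \<bar>a p y\<bar> \<le> 1"
    and zero: "\<And>p. (\<integral>y. a p y \<partial>unif01) = 0"
  shows "(\<integral>x. (\<Sum>i<m. \<Sum>k<n. \<Sum>l<n. a (i,k) (x (i,k)) * h k l * a (i,l) (x (i,l))) \<partial>unif_cube m n)
    = (\<Sum>i<m. \<Sum>k<n. h k k * (\<integral>y. (a (i,k) y)\<^sup>2 \<partial>unif01))"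
proof -
  have bnd2: "\<bar>a p y * a q z\<bar> \<le> 1" for p q y z
    unfolding abs_mult using bnd[of p y] bnd[of q z] by (intro mult_le_one) auto
  have int: "integrable (unif_cube m n) (\<lambda>x. a (i,k) (x (i,k)) * a (i,l) (x (i,l)))"
    if "i < m" "k < n" "l < n" for i k l
  proof -
    note [measurable] = unif_cube_component[OF that(1,2)] unif_cube_component[OF that(1,3)]
    show ?thesis
      using bnd2 by (intro unif_cube.integrable_const_bound[where B = 1]) auto
  qed
  have val: "(\<integral>x. a (i,k) (x (i,k)) * a (i,l) (x (i,l)) \<partial>unif_cube m n)
      = (if k = l then \<integral>y. (a (i,k) y)\<^sup>2 \<partial>unif01 else 0)" if "i < m" "k < n" "l < n" for i k l
    using that zero
    by (intro integral_unif_cube_eq_const[OF int, of _ _ _ "(i,k)"]) (auto simp: power2_eq_square)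
  have "(\<integral>x. (\<Sum>i<m. \<Sum>k<n. \<Sum>l<n. a (i,k) (x (i,k)) * h k l * a (i,l) (x (i,l))) \<partial>unif_cube m n)
    = (\<integral>x. (\<Sum>i<m. \<Sum>k<n. \<Sum>l<n. h k l * (a (i,k) (x (i,k)) * a (i,l) (x (i,l)))) \<partial>unif_cube m n)"
    by (simp add: mult_ac)
  also have "\<dots> = (\<Sum>i<m. \<Sum>k<n. \<Sum>l<n. h k l *
      (\<integral>x. a (i,k) (x (i,k)) * a (i,l) (x (i,l)) \<partial>unif_cube m n))"
    by (rule has_bochner_integral_integral_eq)
      (intro has_bochner_integral_sum has_bochner_integral_mult_right has_bochner_integral_integrable int; simp)
  also have "\<dots> = (\<Sum>i<m. \<Sum>k<n. \<Sum>l<n. if l = k then h k k * (\<integral>y. (a (i,k) y)\<^sup>2 \<partial>unif01) else 0)"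
    by (intro sum.cong refl) (auto simp: val)
  also have "\<dots> = (\<Sum>i<m. \<Sum>k<n. h k k * (\<integral>y. (a (i,k) y)\<^sup>2 \<partial>unif01))"
    by (intro sum.cong refl) (simp add: sum.delta)
  finally show ?thesis .
qed

subsection \<open>Expected loss of LDLQ\<close>

text \<open>Weights and random numbers are arbitrary measurable functions on one space, so the same
  induction serves for \<open>w\<close> alone, for \<open>u\<close> alone and for the pair.\<close>

lemma ldlq_target_measurable:
  assumes Q[measurable]: "(\<lambda>(u,z). Q u z) \<in> borel_measurable (borel \<Otimes>\<^sub>M borel)"
    and b[measurable]: "\<And>j. j < k \<Longrightarrow> b j \<in> borel_measurable M"
    and a[measurable]: "\<And>j. j \<le> k \<Longrightarrow> a j \<in> borel_measurable M"
  shows "(\<lambda>x. ldlq_target (\<lambda>j. Q (b j x)) (\<lambda>j. a j x) U k) \<in> borel_measurable M"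
  using b a
proof (induction k rule: less_induct)
  case (less k)
  have "(\<lambda>x. ldlq_entry (\<lambda>j. Q (b j x)) (\<lambda>j. a j x) U j) \<in> borel_measurable M" if "j < k" for j
  proof -
    have [measurable]: "(\<lambda>x. ldlq_target (\<lambda>j. Q (b j x)) (\<lambda>j. a j x) U j) \<in> borel_measurable M"
      using less that by auto
    have [measurable]: "b j \<in> borel_measurable M"
      using less.prems that by auto
    show ?thesis
      unfolding ldlq_entry_eq by measurable
  qed
  then show ?case
    unfolding ldlq_target_def using less.prems
    by (intro borel_measurable_add borel_measurable_sum borel_measurable_times borel_measurable_diff) auto
qed

text \<open>Periodicity drives the average case, the bound 1 gives integrability, and the last two
  assumptions are the upper bound and its attainment in the worst case.\<close>

locale rounding =
  fixes Q :: "real \<Rightarrow> real \<Rightarrow> real"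
  assumes measurable_Q [measurable]: "(\<lambda>(u,z). Q u z) \<in> borel_measurable (borel \<Otimes>\<^sub>M borel)"
    and periodic: "Q u (z + 1) = Q u z + 1"
    and error_le_1: "\<bar>Q u z - z\<bar> \<le> 1"
    and mean_square_error_le: "(\<integral>u. (Q u z - z)\<^sup>2 \<partial>unif01) \<le> 1/4"
    and mean_square_error_half: "(\<integral>u. (Q u (1/2) - 1/2)\<^sup>2 \<partial>unif01) = 1/4"
begin

abbreviation err :: "real \<Rightarrow> real \<Rightarrow> real" where
  "err u z \<equiv> (Q u z - z)\<^sup>2"

definition avg_err :: real where
  "avg_err = (\<integral>z. (\<integral>u. err u z \<partial>unif01) \<partial>unif01)"

lemma err_bound: "\<bar>err u z\<bar> \<le> 1"
  using error_le_1[of u z] by (simp add: power_le_one_iff abs_square_le_1)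

text \<open>The shift argument integrates over the weight with the random number fixed, the opposite
  of the order in \<open>L_avg\<close>.\<close>

lemma avg_err_swap: "(\<integral>u. (\<integral>z. err u z \<partial>unif01) \<partial>unif01) = avg_err"
  unfolding avg_err_def
  by (rule unif01_pair.Fubini_integral)
    (intro unif01_pair.P.integrable_const_bound[where B = 1], use err_bound in auto)

context
  fixes H D :: "real mat" and m n :: nat
  assumes ldl: "ldl_decomp H (ldl_U H) D" and H: "H \<in> carrier_mat n n"
begin

definition target :: "(nat \<times> nat \<Rightarrow> real) \<Rightarrow> (nat \<times> nat \<Rightarrow> real) \<Rightarrow> nat \<Rightarrow> nat \<Rightarrow> real" where
  "target w u i = ldlq_target (\<lambda>k. Q (u (i,k))) (\<lambda>j. w (i,j)) (ldl_U H)"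

lemma proxy_LDLQ_target:
  assumes "W \<in> carrier_mat m n"
  shows "proxy (LDLQ Q W H u) W H =
    (\<Sum>i<m. \<Sum>k<n. D $$ (k,k) * err (u (i,k)) (target (\<lambda>p. W $$ p) u i k))"
  unfolding target_def by (rule proxy_LDLQ[OF ldl H assms])

lemma target_measurable:
  assumes "i < m" "k < n"
  shows "(\<lambda>(w,u). target w u i k) \<in> borel_measurable (unif_cube m n \<Otimes>\<^sub>M unif_cube m n)"
    and "(\<lambda>u. target w u i k) \<in> borel_measurable (unif_cube m n)"
    and "(\<lambda>w. target w u i k) \<in> borel_measurable (unif_cube m n)"
  unfolding target_def case_prod_beta
  using assms
  by (auto intro!: ldlq_target_measurable measurable_Q unif_cube_component
      measurable_compose[OF measurable_fst] measurable_compose[OF measurable_snd])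

lemma err_integrable:
  assumes "i < m" "k < n"
  shows "integrable (unif_cube m n \<Otimes>\<^sub>M unif_cube m n) (\<lambda>(w,u). err (u (i,k)) (target w u i k))"
    and "integrable (unif_cube m n) (\<lambda>u. err (u (i,k)) (target w u i k))"
    and "integrable (unif_cube m n) (\<lambda>w. err v (target w u i k))"
proof -
  note [measurable] = target_measurable[OF assms] unif_cube_component[OF assms]
  show "integrable (unif_cube m n \<Otimes>\<^sub>M unif_cube m n) (\<lambda>(w,u). err (u (i,k)) (target w u i k))"
    using err_bound by (intro unif_cube_pair.P.integrable_const_bound[where B = 1]) auto
  show "integrable (unif_cube m n) (\<lambda>u. err (u (i,k)) (target w u i k))"
    using err_bound by (intro unif_cube.integrable_const_bound[where B = 1]) auto
  show "integrable (unif_cube m n) (\<lambda>w. err v (target w u i k))"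
    using err_bound by (intro unif_cube.integrable_const_bound[where B = 1]) auto
qed

text \<open>The target does not see \<open>u (i,k)\<close>. Integrating that coordinate first leaves
  the mean square error at a fixed number.\<close>

lemma integral_err_le:
  assumes ik: "i < m" "k < n"
  shows "(\<integral>u. err (u (i,k)) (target w u i k) \<partial>unif_cube m n) \<le> 1/4"
proof (rule integral_unif_cube_le_const[OF err_integrable(2)[OF ik], of "(i,k)"])
  fix u :: "nat \<times> nat \<Rightarrow> real"
  have "target w (u((i,k) := y)) i k = target w u i k" for y
    unfolding target_def by (rule ldlq_target_cong) auto
  then show "(\<integral>y. err ((u((i,k) := y)) (i,k)) (target w (u((i,k) := y)) i k) \<partial>unif01) \<le> 1/4"
    using mean_square_error_le by simp
qed (use ik in auto)

text \<open>Given the earlier entries of its row, the target is a translate of the uniform variable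
  \<open>w (i,k)\<close>, hence uniform modulo 1.\<close>

lemma integral_integral_err:
  assumes ik: "i < m" "k < n"
  shows "(\<integral>w. (\<integral>u. err (u (i,k)) (target w u i k) \<partial>unif_cube m n) \<partial>unif_cube m n) = avg_err"
proof -
  have meas: "(\<lambda>z. err v z) \<in> borel_measurable borel" for v
    by measurable
  \<comment> \<open>The random number \<open>v\<close> of the current rounding is decoupled from
    \<open>u\<close>; it becomes \<open>u (i,k)\<close> after the exchange of integrals.\<close>
  have 1: "(\<integral>w. err v (target w u i k) \<partial>unif_cube m n) = (\<integral>y. err v y \<partial>unif01)" for u v
  proof (rule integral_unif_cube_eq_const[OF err_integrable(3)[OF ik], of "(i,k)"])
    fix w :: "nat \<times> nat \<Rightarrow> real"
    define c where "c = target w u i k - w (i,k)"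
    have "target (w((i,k) := y)) u i k = y + c" for y
    proof -
      have "ldlq_entry (\<lambda>k. Q (u (i,k))) (\<lambda>j. (w((i,k) := y)) (i,j)) (ldl_U H) l =
          ldlq_entry (\<lambda>k. Q (u (i,k))) (\<lambda>j. w (i,j)) (ldl_U H) l" if "l < k" for l
        unfolding ldlq_entry_eq
        by (rule arg_cong[where f = "Q _"], rule ldlq_target_cong) (use that in auto)
      then show ?thesis
        by (simp add: c_def target_def ldlq_target_def)
    qed
    then show "(\<integral>y. err v (target (w((i,k) := y)) u i k) \<partial>unif01) = (\<integral>y. err v y \<partial>unif01)"
      using integral_unif01_shift[OF meas, of v 1 c] err_bound periodic by simp
  qed (use ik in auto)
  have "(\<integral>w. (\<integral>u. err (u (i,k)) (target w u i k) \<partial>unif_cube m n) \<partial>unif_cube m n)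
      = (\<integral>u. (\<integral>w. err (u (i,k)) (target w u i k) \<partial>unif_cube m n) \<partial>unif_cube m n)"
    by (rule unif_cube_pair.Fubini_integral[symmetric]) (rule err_integrable(1)[OF ik])
  also have "\<dots> = (\<integral>u. (\<integral>y. err (u (i,k)) y \<partial>unif01) \<partial>unif_cube m n)"
    unfolding 1 ..
  also have "\<dots> = (\<integral>v. (\<integral>y. err v y \<partial>unif01) \<partial>unif01)"
  proof (rule integral_unif_cube_component(2)[OF _ _ ik])
    show "(\<lambda>v. \<integral>y. err v y \<partial>unif01) \<in> borel_measurable borel"
      by measurable
    show "\<bar>\<integral>y. err v y \<partial>unif01\<bar> \<le> 1" for v
    proof -
      have "integrable unif01 (err v)"
        using err_bound by (intro unif01.integrable_const_bound[where B = 1]) auto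
      then have "(\<integral>y. err v y \<partial>unif01) \<le> 1"
        using err_bound[of v] by (intro unif01.integral_le_const) (auto simp: abs_le_iff)
      then show ?thesis by simp
    qed
  qed
  also have "\<dots> = avg_err" by (rule avg_err_swap)
  finally show ?thesis .
qed

lemma integral_proxy_LDLQ:
  assumes "W \<in> carrier_mat m n"
  shows "(\<integral>u. proxy (LDLQ Q W H u) W H \<partial>unif_cube m n) =
    (\<Sum>i<m. \<Sum>k<n. D $$ (k,k) * (\<integral>u. err (u (i,k)) (target (\<lambda>p. W $$ p) u i k) \<partial>unif_cube m n))"
  unfolding proxy_LDLQ_target[OF assms]
  by (rule integral_weighted_sum) (auto intro: err_integrable(2))

lemma L_worst_LDLQ_le: "L_worst (LDLQ Q) m H \<le> ereal (real m / 4 * mtrace H)"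
  unfolding L_worst_def
proof (rule SUP_least)
  fix W :: "real mat" assume "W \<in> carrier_mat m (dim_row H)"
  then have W: "W \<in> carrier_mat m n" using H by simp
  have "(\<integral>u. proxy (LDLQ Q W H u) W H \<partial>unif_cube m n) \<le> (\<Sum>i<m. \<Sum>k<n. D $$ (k,k) * (1/4))"
    unfolding integral_proxy_LDLQ[OF W]
    using integral_err_le ldl_decomp_diag_nonneg[OF ldl H]
    by (intro sum_mono mult_left_mono) auto
  also have "\<dots> = real m / 4 * (\<Sum>k<n. D $$ (k,k))"
    by (simp add: sum_divide_distrib[symmetric])
  also have "\<dots> \<le> real m / 4 * mtrace H"
    using ldl_decomp_trace_le[OF ldl H] by (intro mult_left_mono) auto
  finally show "ereal (\<integral>u. proxy (LDLQ Q W H u) W H \<partial>unif_cube m (dim_row H)) \<le> ereal (real m / 4 * mtrace H)"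
    using H by simp
qed

lemma L_worst_LDLQ_diagonal:
  assumes diag: "diagonal_mat H"
  shows "ereal (real m / 4 * mtrace H) \<le> L_worst (LDLQ Q) m H"
proof -
  \<comment> \<open>All entries sit at 1/2, where the mean square error reaches its bound
    1/4.\<close>
  define W where "W = Matrix.mat m n (\<lambda>_. 1/2 :: real)"
  have W: "W \<in> carrier_mat m n" by (simp add: W_def)
  note D = ldl_decomp_diagonal_mat[OF ldl H diag]
  have "D $$ (k,k) * (\<integral>u. err (u (i,k)) (target (\<lambda>p. W $$ p) u i k) \<partial>unif_cube m n) = H $$ (k,k) * (1/4)"
    if ik: "i < m" "k < n" for i k
  \<comment> \<open>The chosen \<open>ldl_U H\<close> may have a nonzero column at a zero pivot, but
    the errors there have weight 0.\<close>
  proof (cases "D $$ (k,k) = 0")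
    case True
    then show ?thesis using D[OF ik(2)] by simp
  next
    case False
    then have "\<forall>j<k. ldl_U H $$ (j,k) = 0" using D[OF ik(2)] by auto
    then have "target (\<lambda>p. W $$ p) u i k = 1/2" for u
      using ik by (simp add: target_def ldlq_target_def W_def)
    then have "(\<integral>u. err (u (i,k)) (target (\<lambda>p. W $$ p) u i k) \<partial>unif_cube m n)
        = (\<integral>u. err (u (i,k)) (1/2) \<partial>unif_cube m n)"
      by (simp only:)
    also have "(\<integral>u. err (u (i,k)) (1/2) \<partial>unif_cube m n) = (\<integral>y. err y (1/2) \<partial>unif01)"
      by (rule integral_unif_cube_component(2)[where B = 1, OF _ _ ik]) (use err_bound in auto)
    finally show ?thesis
      using D[OF ik(2)] mean_square_error_half by simp
  qed
  then have "(\<integral>u. proxy (LDLQ Q W H u) W H \<partial>unif_cube m n) = (\<Sum>i<m. \<Sum>k<n. H $$ (k,k) * (1/4))"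
    unfolding integral_proxy_LDLQ[OF W] by (intro sum.cong refl) (simp only: lessThan_iff)
  also have "\<dots> = real m / 4 * mtrace H"
    using H by (simp add: mtrace_def sum_divide_distrib[symmetric])
  finally show ?thesis
    unfolding L_worst_def using W H by (intro SUP_upper2[of W]) auto
qed

text \<open>An exact value and not only a bound: each entry has the same average error, so the
  decomposition enters through the trace of \<open>D\<close> alone.\<close>

lemma L_avg_LDLQ: "L_avg (LDLQ Q) m H = real m * avg_err * (\<Sum>k<n. D $$ (k,k))"
proof -
  \<comment> \<open>The matrix built from \<open>w\<close> agrees with \<open>w\<close> only inside
    the index range; by causality the target reads nothing outside it.\<close>
  have eq: "target (\<lambda>p. Matrix.mat m n w $$ p) u i k = target w u i k" if "i < m" "k < n" for w u i k
    unfolding target_def by (rule ldlq_target_cong) (use that in auto)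
  have "L_avg (LDLQ Q) m H = (\<integral>w. (\<Sum>i<m. \<Sum>k<n. D $$ (k,k) *
      (\<integral>u. err (u (i,k)) (target w u i k) \<partial>unif_cube m n)) \<partial>unif_cube m n)"
    using H by (simp add: L_avg_def Let_def integral_proxy_LDLQ eq)
  also have "\<dots> = (\<Sum>i<m. \<Sum>k<n. D $$ (k,k) *
      (\<integral>w. (\<integral>u. err (u (i,k)) (target w u i k) \<partial>unif_cube m n) \<partial>unif_cube m n))"
    using unif_cube_pair.integrable_fst'[OF err_integrable(1)]
    by (intro integral_weighted_sum) auto
  also have "\<dots> = (\<Sum>i<m. \<Sum>k<n. D $$ (k,k) * avg_err)"
    by (simp add: integral_integral_err)
  also have "\<dots> = real m * avg_err * (\<Sum>k<n. D $$ (k,k))"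
    by (simp add: sum_distrib_left mult_ac)
  finally show ?thesis .
qed

end

lemma avg_err_nonneg: "0 \<le> avg_err"
  unfolding avg_err_def by (intro Bochner_Integration.integral_nonneg) auto

lemma SUP_L_worst_LDLQ:
  assumes H: "H \<in> carrier_mat n n" "sym_psd H"
  shows "(SUP Ht \<in> same_spectrum_psd H. L_worst (LDLQ Q) m Ht) = ereal (real m / 4 * mtrace H)"
proof (rule antisym)
  show "(SUP Ht \<in> same_spectrum_psd H. L_worst (LDLQ Q) m Ht) \<le> ereal (real m / 4 * mtrace H)"
  proof (rule SUP_least)
    fix Ht assume "Ht \<in> same_spectrum_psd H"
    note Ht = same_spectrum_psd_mtrace[OF H this]
    obtain D where "ldl_decomp Ht (ldl_U Ht) D"
      using ldl_U_decomp[OF Ht(1,2)] .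
    from L_worst_LDLQ_le[OF this Ht(1)]
    show "L_worst (LDLQ Q) m Ht \<le> ereal (real m / 4 * mtrace H)"
      unfolding Ht(3) .
  qed
  obtain L where L: "L \<in> same_spectrum_psd H" "diagonal_mat L"
    using diagonal_mat_same_spectrum[OF H] .
  note Lt = same_spectrum_psd_mtrace[OF H L(1)]
  obtain D where "ldl_decomp L (ldl_U L) D"
    using ldl_U_decomp[OF Lt(1,2)] .
  from L_worst_LDLQ_diagonal[OF this Lt(1) L(2)]
  show "ereal (real m / 4 * mtrace H) \<le> (SUP Ht \<in> same_spectrum_psd H. L_worst (LDLQ Q) m Ht)"
    unfolding Lt(3) by (rule SUP_upper2[OF L(1)])
qed

lemma SUP_L_avg_LDLQ:
  assumes H: "H \<in> carrier_mat n n" "sym_psd H"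
  shows "(SUP Ht \<in> same_spectrum_psd H. ereal (L_avg (LDLQ Q) m Ht)) = ereal (real m * avg_err * mtrace H)"
proof (rule antisym)
  show "(SUP Ht \<in> same_spectrum_psd H. ereal (L_avg (LDLQ Q) m Ht)) \<le> ereal (real m * avg_err * mtrace H)"
  proof (rule SUP_least)
    fix Ht assume "Ht \<in> same_spectrum_psd H"
    note Ht = same_spectrum_psd_mtrace[OF H this]
    obtain D where D: "ldl_decomp Ht (ldl_U Ht) D"
      using ldl_U_decomp[OF Ht(1,2)] .
    show "ereal (L_avg (LDLQ Q) m Ht) \<le> ereal (real m * avg_err * mtrace H)"
      unfolding L_avg_LDLQ[OF D Ht(1)] Ht(3)[symmetric] ereal_less_eq(3)
      using ldl_decomp_trace_le[OF D Ht(1)] avg_err_nonneg by (intro mult_left_mono) auto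
  qed
  obtain L where L: "L \<in> same_spectrum_psd H" "diagonal_mat L"
    using diagonal_mat_same_spectrum[OF H] .
  note Lt = same_spectrum_psd_mtrace[OF H L(1)]
  obtain D where D: "ldl_decomp L (ldl_U L) D"
    using ldl_U_decomp[OF Lt(1,2)] .
  have "(\<Sum>k<n. D $$ (k,k)) = mtrace H"
    unfolding Lt(3)[symmetric] using ldl_decomp_diagonal_mat[OF D Lt(1) L(2)] Lt(1)
    by (simp add: mtrace_def)
  then have "L_avg (LDLQ Q) m L = real m * avg_err * mtrace H"
    using L_avg_LDLQ[OF D Lt(1)] by simp
  then show "ereal (real m * avg_err * mtrace H) \<le> (SUP Ht \<in> same_spectrum_psd H. ereal (L_avg (LDLQ Q) m Ht))"
    by (intro SUP_upper2[OF L(1)]) simp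
qed

end

subsection \<open>Nearest and stochastic rounding\<close>

text \<open>After a shift by 1/2 nearest rounding is the floor, so its error is a centered
  fractional part.\<close>

lemma near_round_shift: "near_round u (z - 1/2) - (z - 1/2) = 1/2 - frac z"
  by (simp add: near_round_def frac_def)

lemma near_round_error_le: "\<bar>near_round u z - z\<bar> \<le> 1/2"
proof -
  have "near_round u z - z = 1/2 - frac (z + 1/2)"
    using near_round_shift[of u "z + 1/2"] by simp
  then show ?thesis
    using frac_ge_0[of "z + 1/2"] frac_lt_1[of "z + 1/2"] by linarith
qed

lemma near_round_square_error_le: "(near_round u z - z)\<^sup>2 \<le> 1/4"
  using power_mono[OF near_round_error_le[of u z], of 2] by (simp add: power2_eq_square)

lemma near_round_measurable [measurable]: "near_round u \<in> borel_measurable borel"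
  unfolding near_round_def by measurable

lemma near_round_plus_1: "near_round u (z + 1) = near_round u z + 1"
proof -
  have "z + 1 + 1/2 = (z + 1/2) + 1" by simp
  then show ?thesis unfolding near_round_def by (simp only: one_add_floor[symmetric] of_int_add of_int_1)
qed

text \<open>The error is 1-periodic, so the window may be moved by 1/2 to where it is
  \<open>1/2 - z\<close> without a jump inside. A general \<open>f\<close> covers the mean and the
  mean square at once.\<close>

lemma integral_near_round:
  fixes f :: "real \<Rightarrow> real"
  assumes [measurable]: "f \<in> borel_measurable borel" and bnd: "\<And>x. \<bar>x\<bar> \<le> 1/2 \<Longrightarrow> \<bar>f x\<bar> \<le> B"
  shows "(\<integral>z. f (near_round u z - z) \<partial>unif01) = (\<integral>z. f (1/2 - z) \<partial>unif01)"
proof -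
  have "(\<integral>z. f (near_round u z - z) \<partial>unif01) = (\<integral>z. f (near_round u (z + -1/2) - (z + -1/2)) \<partial>unif01)"
    using near_round_plus_1 bnd near_round_error_le
    by (intro integral_unif01_shift[where B = B, symmetric]) auto
  also have "\<dots> = (\<integral>z. f (1/2 - z) \<partial>unif01)"
  proof (rule integral_unif01_cong)
    fix z :: real assume "0 \<le> z" "z < 1"
    then have "near_round u (z + -1/2) - (z + -1/2) = 1/2 - z"
      using near_round_shift[of u z] frac_eq[of z] by simp
    then show "f (near_round u (z + -1/2) - (z + -1/2)) = f (1/2 - z)"
      by (rule arg_cong)
  qed measurable
  finally show ?thesis .
qed

lemma integral_near_round_error: "(\<integral>z. near_round u z - z \<partial>unif01) = 0"
proof -
  have "(\<integral>z. near_round u z - z \<partial>unif01) = (\<integral>z. 1/2 - z \<partial>unif01)"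
    by (rule integral_near_round[where f = "\<lambda>x. x" and B = "1/2"]) auto
  also have "\<dots> = (1/2 * 1 - 1\<^sup>2/2) - (1/2 * 0 - 0\<^sup>2/2)"
    by (rule integral_unif01_FTC[where F = "\<lambda>z. 1/2 * z - z\<^sup>2/2"])
      (auto intro!: derivative_eq_intros)
  finally show ?thesis by simp
qed

lemma integral_near_round_square_error: "(\<integral>z. (near_round u z - z)\<^sup>2 \<partial>unif01) = 1/12"
proof -
  have "(\<integral>z. (near_round u z - z)\<^sup>2 \<partial>unif01) = (\<integral>z. (1/2 - z)\<^sup>2 \<partial>unif01)"
    by (rule integral_near_round[where f = "\<lambda>x. x\<^sup>2" and B = 1]) (auto simp: abs_square_le_1)
  also have "\<dots> = (- ((1/2 - 1)^3/3)) - (- ((1/2 - 0)^3/3))"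
    by (rule integral_unif01_FTC[where F = "\<lambda>z. - ((1/2 - z)^3/3)"])
      (auto intro!: derivative_eq_intros)
  finally show ?thesis by (simp add: power3_eq_cube)
qed

section \<open>Stochastic rounding: centered Bernoulli errors\<close>

lemma stoch_round_error: "stoch_round u z - z = indicator {..<frac z} u - frac z"
  by (auto simp: stoch_round_def frac_def indicator_def)

lemma stoch_round_error_le: "\<bar>stoch_round u z - z\<bar> \<le> 1"
  unfolding stoch_round_error using frac_ge_0[of z] frac_lt_1[of z] by (auto simp: indicator_def)

lemma integral_unif01_indicator:
  assumes "0 \<le> b" "b \<le> 1"
  shows "(\<integral>u. indicat_real {..<b} u \<partial>unif01) = b"
proof -
  have "(\<integral>u. indicat_real {..<b} u \<partial>unif01) = (\<integral>x. indicat_real {..<b} x * indicator {0..1} x \<partial>lborel)"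
    by (rule integral_unif01) measurable
  also have "\<dots> = (\<integral>x. indicat_real {0..<b} x \<partial>lborel)"
    using assms by (intro Bochner_Integration.integral_cong refl) (auto simp: indicator_def)
  also have "\<dots> = b"
    using assms by simp
  finally show ?thesis .
qed

lemma integrable_unif01_indicator: "integrable unif01 (indicator {..<b} :: real \<Rightarrow> real)"
  by (intro unif01.integrable_const_bound[where B = 1]) auto

lemma integral_stoch_round_error: "(\<integral>u. stoch_round u z - z \<partial>unif01) = 0"
  unfolding stoch_round_error
  using integral_unif01_indicator[of "frac z"] integrable_unif01_indicator[of "frac z"] frac_lt_1[of z]
  by (simp add: unif01.prob_space[simplified])

lemma integral_stoch_round_square_error:
  "(\<integral>u. (stoch_round u z - z)\<^sup>2 \<partial>unif01) = frac z * (1 - frac z)"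
proof -
  \<comment> \<open>An indicator equals its own square, so the squared error is affine in it and its
    integral is the variance of a Bernoulli variable with mean \<open>frac z\<close>.\<close>
  have "(stoch_round u z - z)\<^sup>2 = (1 - 2 * frac z) * indicator {..<frac z} u + (frac z)\<^sup>2" for u
    unfolding stoch_round_error by (auto simp: indicator_def power2_eq_square algebra_simps)
  then have "(\<integral>u. (stoch_round u z - z)\<^sup>2 \<partial>unif01) =
      (\<integral>u. (1 - 2 * frac z) * indicator {..<frac z} u + (frac z)\<^sup>2 \<partial>unif01)"
    by (simp only:)
  also have "\<dots> = frac z * (1 - frac z)"
    using integral_unif01_indicator[of "frac z"] integrable_unif01_indicator[of "frac z"] frac_lt_1[of z]
    by (simp add: unif01.prob_space[simplified] power2_eq_square algebra_simps)
  finally show ?thesis .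
qed

lemma frac_mult_one_minus_frac:
  fixes z :: real
  shows "0 \<le> frac z * (1 - frac z)" "frac z * (1 - frac z) \<le> 1/4"
proof -
  show "0 \<le> frac z * (1 - frac z)"
    using frac_ge_0[of z] frac_lt_1[of z] by simp
  have "0 \<le> (frac z - 1/2)\<^sup>2" by simp
  then show "frac z * (1 - frac z) \<le> 1/4"
    by (simp add: power2_eq_square algebra_simps)
qed

lemma frac_measurable [measurable]: "(frac :: real \<Rightarrow> real) \<in> borel_measurable borel"
  unfolding frac_def by measurable

lemma integral_frac_variance: "(\<integral>z. frac z * (1 - frac z) \<partial>unif01) = 1/6"
proof -
  have "(\<integral>z. frac z * (1 - frac z) \<partial>unif01) = (\<integral>z. z * (1 - z) \<partial>unif01)"
    by (intro integral_unif01_cong) (auto simp: frac_eq[THEN iffD2])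
  also have "\<dots> = (1\<^sup>2/2 - 1^3/3) - (0\<^sup>2/2 - 0^3/3)"
    by (rule integral_unif01_FTC[where F = "\<lambda>z. z\<^sup>2/2 - z^3/3"])
      (auto intro!: derivative_eq_intros simp: power2_eq_square algebra_simps)
  finally show ?thesis by simp
qed

section \<open>Instances of the rounding locale and losses of entrywise rounding\<close>

interpretation near: rounding near_round
proof
  show "(\<lambda>(u,z). near_round u z) \<in> borel_measurable (borel \<Otimes>\<^sub>M borel)"
    unfolding near_round_def by measurable
  show "\<bar>near_round u z - z\<bar> \<le> 1" for u z
    using near_round_error_le[of u z] by simp
  show "(\<integral>u. (near_round u z - z)\<^sup>2 \<partial>unif01) \<le> 1/4" for z
    using near_round_square_error_le[of 0 z]
    by (simp add: near_round_def unif01.prob_space[simplified])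
  show "(\<integral>u. (near_round u (1/2) - 1/2)\<^sup>2 \<partial>unif01) = 1/4"
    by (simp add: near_round_def unif01.prob_space[simplified] power2_eq_square)
qed (rule near_round_plus_1)

interpretation stoch: rounding stoch_round
proof
  show "(\<lambda>(u,z). stoch_round u z) \<in> borel_measurable (borel \<Otimes>\<^sub>M borel)"
    unfolding stoch_round_def by measurable
  show "stoch_round u (z + 1) = stoch_round u z + 1" for u z
    by (simp add: stoch_round_def)
  show "(\<integral>u. (stoch_round u z - z)\<^sup>2 \<partial>unif01) \<le> 1/4" for z
    unfolding integral_stoch_round_square_error by (rule frac_mult_one_minus_frac(2))
  show "(\<integral>u. (stoch_round u (1/2) - 1/2)\<^sup>2 \<partial>unif01) = 1/4"
    unfolding integral_stoch_round_square_error by (simp add: frac_eq[THEN iffD2])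
qed (rule stoch_round_error_le)

text \<open>For nearest rounding the integral over \<open>z\<close> is known for each
  \<open>u\<close>, hence the swapped order. For stochastic rounding the inner integral over
  \<open>u\<close> is the Bernoulli variance, and the original order fits.\<close>

lemma near_avg_err: "near.avg_err = 1/12"
  unfolding near.avg_err_swap[symmetric] integral_near_round_square_error
  by (simp add: unif01.prob_space[simplified])

lemma stoch_avg_err: "stoch.avg_err = 1/6"
  unfolding stoch.avg_err_def integral_stoch_round_square_error by (rule integral_frac_variance)

lemma integral_proxy_entrywise_stoch:
  assumes "W \<in> carrier_mat m n" "H \<in> carrier_mat n n"
  shows "(\<integral>u. proxy (entrywise stoch_round W H u) W H \<partial>unif_cube m n) =
    (\<Sum>i<m. \<Sum>k<n. H $$ (k,k) * (frac (W $$ (i,k)) * (1 - frac (W $$ (i,k)))))"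
  unfolding proxy_entrywise[OF assms] integral_stoch_round_square_error[symmetric]
\<comment> \<open>For fixed \<open>W\<close> each error depends on its own random number only and is
  centered, whatever the weight is.\<close>
proof (rule integral_unif_cube_quadratic_form)
  show "(\<lambda>y. stoch_round y (W $$ p) - W $$ p) \<in> borel_measurable borel" for p
    unfolding stoch_round_def by measurable
qed (rule stoch_round_error_le integral_stoch_round_error)+

lemma L_worst_entrywise_stoch:
  assumes H: "H \<in> carrier_mat n n" "sym_psd H"
  shows "L_worst (entrywise stoch_round) m H = ereal (real m / 4 * mtrace H)"
proof (rule antisym)
  obtain D where D: "ldl_decomp H (ldl_U H) D"
    using ldl_U_decomp[OF H] .
  \<comment> \<open>The diagonal of \<open>H\<close> dominates the nonnegative pivots.\<close>
  have nonneg: "0 \<le> H $$ (k,k)" if "k < n" for k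
    using ldl_decomp_diag_le[OF D H(1) that] ldl_decomp_diag_nonneg[OF D H(1) that] by linarith
  have tr: "(\<Sum>i<m. \<Sum>k<n. H $$ (k,k) * (1/4)) = real m / 4 * mtrace H"
    using H(1) by (simp add: mtrace_def sum_divide_distrib[symmetric])
  show "L_worst (entrywise stoch_round) m H \<le> ereal (real m / 4 * mtrace H)"
    unfolding L_worst_def
  proof (rule SUP_least)
    fix W :: "real mat" assume "W \<in> carrier_mat m (dim_row H)"
    then have W: "W \<in> carrier_mat m n" using H by simp
    have "(\<integral>u. proxy (entrywise stoch_round W H u) W H \<partial>unif_cube m n)
        \<le> (\<Sum>i<m. \<Sum>k<n. H $$ (k,k) * (1/4))"
      unfolding integral_proxy_entrywise_stoch[OF W H(1)]
      using nonneg frac_mult_one_minus_frac(2) by (intro sum_mono mult_left_mono) auto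
    also note tr
    finally show "ereal (\<integral>u. proxy (entrywise stoch_round W H u) W H \<partial>unif_cube m (dim_row H))
        \<le> ereal (real m / 4 * mtrace H)"
      using H by simp
  qed
  define W where "W = Matrix.mat m n (\<lambda>_. 1/2 :: real)"
  have W: "W \<in> carrier_mat m n" by (simp add: W_def)
  have "(\<integral>u. proxy (entrywise stoch_round W H u) W H \<partial>unif_cube m n)
      = (\<Sum>i<m. \<Sum>k<n. H $$ (k,k) * (1/4))"
    unfolding integral_proxy_entrywise_stoch[OF W H(1)]
    by (intro sum.cong refl) (simp add: W_def frac_eq[THEN iffD2])
  also note tr
  finally show "ereal (real m / 4 * mtrace H) \<le> L_worst (entrywise stoch_round) m H"
    unfolding L_worst_def using W H by (intro SUP_upper2[of W]) auto
qed

lemma L_avg_entrywise_stoch: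
  assumes H: "H \<in> carrier_mat n n"
  shows "L_avg (entrywise stoch_round) m H = real m / 6 * mtrace H"
proof -
  have b: "\<bar>frac z * (1 - frac z)\<bar> \<le> 1" for z :: real
    using frac_mult_one_minus_frac[of z] by linarith
  have m: "(\<lambda>z. frac z * (1 - frac z) :: real) \<in> borel_measurable borel" by measurable
  note c = integral_unif_cube_component[OF m b]
  have "L_avg (entrywise stoch_round) m H =
      (\<integral>w. (\<Sum>i<m. \<Sum>k<n. H $$ (k,k) * (frac (w (i,k)) * (1 - frac (w (i,k))))) \<partial>unif_cube m n)"
    using H by (simp add: L_avg_def Let_def integral_proxy_entrywise_stoch)
  also have "\<dots> = (\<Sum>i<m. \<Sum>k<n. H $$ (k,k) * (1/6))"
    by (subst integral_weighted_sum) (auto simp: c integral_frac_variance)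
  also have "\<dots> = real m / 6 * mtrace H"
    using H by (simp add: mtrace_def sum_divide_distrib[symmetric])
  finally show ?thesis .
qed

text \<open>Here independence and centering come from the random weights instead of the rounding:
  the nearest error has mean zero over a period. The rounding ignores \<open>u\<close>, so 0 can
  stand for it.\<close>

lemma L_avg_entrywise_near:
  assumes H: "H \<in> carrier_mat n n"
  shows "L_avg (entrywise near_round) m H = real m / 12 * mtrace H"
proof -
  let ?e = "\<lambda>z. near_round 0 z - z"
  have "L_avg (entrywise near_round) m H =
      (\<integral>w. (\<Sum>i<m. \<Sum>k<n. \<Sum>l<n. ?e (w (i,k)) * H $$ (k,l) * ?e (w (i,l))) \<partial>unif_cube m n)"
    using H by (simp add: L_avg_def Let_def proxy_entrywise[of _ m n] near_round_def unif_cube.prob_space)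
  also have "\<dots> = (\<Sum>i<m. \<Sum>k<n. H $$ (k,k) * (\<integral>y. (?e y)\<^sup>2 \<partial>unif01))"
    by (rule integral_unif_cube_quadratic_form)
      (use near.error_le_1 integral_near_round_error in auto)
  also have "\<dots> = real m / 12 * mtrace H"
    using H by (simp add: integral_near_round_square_error mtrace_def sum_divide_distrib[symmetric])
  finally show ?thesis .
qed

theorem theorem4:
  fixes m n :: nat and H :: "real mat"
  assumes "H \<in> carrier_mat n n" and "sym_psd H"
  shows
    "(SUP Ht \<in> same_spectrum_psd H. L_worst (LDLQ near_round) m Ht) = L_worst (entrywise stoch_round) m H
     \<and> (SUP Ht \<in> same_spectrum_psd H. L_worst (LDLQ stoch_round) m Ht) = L_worst (entrywise stoch_round) m H
     \<and> L_worst (entrywise stoch_round) m H = ereal (real m / 4 * mtrace H)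
     \<and> (SUP Ht \<in> same_spectrum_psd H. ereal (L_avg (LDLQ near_round) m Ht)) = ereal (L_avg (entrywise near_round) m H)
     \<and> L_avg (entrywise near_round) m H = real m / 12 * mtrace H
     \<and> (SUP Ht \<in> same_spectrum_psd H. ereal (L_avg (LDLQ stoch_round) m Ht)) = ereal (L_avg (entrywise stoch_round) m H)
     \<and> L_avg (entrywise stoch_round) m H = real m / 6 * mtrace H"
  using near.SUP_L_worst_LDLQ[OF assms] stoch.SUP_L_worst_LDLQ[OF assms]
    near.SUP_L_avg_LDLQ[OF assms] stoch.SUP_L_avg_LDLQ[OF assms]
    L_worst_entrywise_stoch[OF assms] L_avg_entrywise_near[OF assms(1)] L_avg_entrywise_stoch[OF assms(1)]
  by (simp add: near_avg_err stoch_avg_err)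

end
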